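(* Let $G$ be a connected solvable Lie group with Lie algebra $\mathfrak{g}$ and consider a discrete-time linear control system $g_{k+1}=f(g_k,u_k)$ on $G$ with control range $U\subset\mathbb{R}^m$ a compact neighborhood of $0$. If $\mathcal{R}$ and $\mathcal{C}$ are open and $G^0=G$, then the system is controllable.
   Context: A discrete-time linear control system on a connected Lie group $G$ (identity $e$) is given by a map $f:G\times U\to G$, $f_u:=f(\cdot,u)$, where $U\subset\mathbb{R}^m$ is a compact neighborhood of $0$, such that $f_0$ is a Lie group automorphism of $G$ and $f_u(g)=f_u(e)\cdot f_0(g)$ for all $g\in G$, $u\in U$. Controls are sequences $u=(u_i)_{i\in\mathbb{N}_0}\in U^{\mathbb{N}_0}$; the solution is $\varphi(0,g,u)=g$ and $\varphi(k,g,u)=f_{u_{k-1}}\circ\cdots\circ f_{u_0}(g)$ for $k\ge1$. $\mathcal{R}=\bigcup_{k\in\mathbb{N}}\{\varphi(k,e,u)\}$ is the reachable set from $e$, $\mathcal{C}=\bigcup_{k\in\mathbb{N}}\{g:\varphi(k,g,u)=e\text{ for some }u\}$ the controllable set to $e$. The system is controllable if every $h\in G$ can be reached from every $g\in G$ by some solution. With $df_0=d(f_0)_e$, $\mathfrak{g}^0$ is the sum of the (real) generalized eigenspaces of $df_0$ for eigenvalues of modulus $1$, and $G^0$ is the connected Lie subgroup with Lie algebra $\mathfrak{g}^0$. *)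

theory Defs
  imports "HOL-Analysis.Analysis" "HOL-Algebra.Solvable_Groups"
begin

text \<open>f is smooth on the open set S iff it has Frechet derivatives of every order on S.
  D vs x is the iterated derivative of f at x applied to the directions in the list vs.\<close>
definition smooth_on :: "'a::euclidean_space set \<Rightarrow> ('a \<Rightarrow> 'b::euclidean_space) \<Rightarrow> bool" where
  "smooth_on S f \<longleftrightarrow> open S \<and>
     (\<exists>D :: 'a list \<Rightarrow> 'a \<Rightarrow> 'b.
        (\<forall>x\<in>S. D [] x = f x) \<and>
        (\<forall>vs. \<forall>x\<in>S. ((D vs) has_derivative (\<lambda>v. D (v # vs) x)) (at x)))"

type_synonym ('g, 'n) chart = "'g set \<times> ('g \<Rightarrow> real^'n) \<times> (real^'n \<Rightarrow> 'g)"

definition is_chart :: "('g::topological_space, 'n::finite) chart \<Rightarrow> bool" where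
  "is_chart c = (case c of (U, \<phi>, \<psi>) \<Rightarrow>
      open U \<and> open (\<phi> ` U) \<and> homeomorphism U (\<phi> ` U) \<phi> \<psi>)"

definition lie_group ::
  "('g::t2_space, 'b) monoid_scheme \<Rightarrow> ('g, 'n::finite) chart set \<Rightarrow> bool" where
  "lie_group G A \<longleftrightarrow> group G \<and> carrier G = UNIV \<and>
     (\<forall>c\<in>A. is_chart c) \<and>
     (\<forall>x. \<exists>(U, \<phi>, \<psi>)\<in>A. x \<in> U) \<and>
     (\<forall>(U1, \<phi>1, \<psi>1)\<in>A. \<forall>(U2, \<phi>2, \<psi>2)\<in>A.
        smooth_on (\<phi>1 ` (U1 \<inter> U2)) (\<phi>2 \<circ> \<psi>1)) \<and>
     (\<forall>(U1, \<phi>1, \<psi>1)\<in>A. \<forall>(U2, \<phi>2, \<psi>2)\<in>A. \<forall>(U3, \<phi>3, \<psi>3)\<in>A.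
        smooth_on {(x, y). x \<in> \<phi>1 ` U1 \<and> y \<in> \<phi>2 ` U2 \<and> \<psi>1 x \<otimes>\<^bsub>G\<^esub> \<psi>2 y \<in> U3}
                  (\<lambda>(x, y). \<phi>3 (\<psi>1 x \<otimes>\<^bsub>G\<^esub> \<psi>2 y))) \<and>
     (\<forall>(U1, \<phi>1, \<psi>1)\<in>A. \<forall>(U2, \<phi>2, \<psi>2)\<in>A.
        smooth_on {x. x \<in> \<phi>1 ` U1 \<and> inv\<^bsub>G\<^esub> (\<psi>1 x) \<in> U2}
                  (\<lambda>x. \<phi>2 (inv\<^bsub>G\<^esub> (\<psi>1 x))))"

definition smooth_map :: "('g::topological_space, 'n::finite) chart set \<Rightarrow> ('g \<Rightarrow> 'g) \<Rightarrow> bool" where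
  "smooth_map A h \<longleftrightarrow> continuous_on UNIV h \<and>
     (\<forall>(U1, \<phi>1, \<psi>1)\<in>A. \<forall>(U2, \<phi>2, \<psi>2)\<in>A.
        smooth_on {x. x \<in> \<phi>1 ` U1 \<and> h (\<psi>1 x) \<in> U2} (\<lambda>x. \<phi>2 (h (\<psi>1 x))))"

definition lie_automorphism ::
  "('g::topological_space, 'b) monoid_scheme \<Rightarrow> ('g, 'n::finite) chart set \<Rightarrow> ('g \<Rightarrow> 'g) \<Rightarrow> bool" where
  "lie_automorphism G A h \<longleftrightarrow> h \<in> iso G G \<and> smooth_map A h \<and> smooth_map A (inv_into UNIV h)"

definition complexify_mat :: "real^'n^'n \<Rightarrow> complex^'n^'n" where
  "complexify_mat M = (\<chi> i j. complex_of_real (M $ i $ j))"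

definition complexify_vec :: "real^'n \<Rightarrow> complex^'n" where
  "complexify_vec v = (\<chi> i. complex_of_real (v $ i))"

definition gen_eigenspace :: "complex^'n^'n \<Rightarrow> complex \<Rightarrow> (complex^'n) set" where
  "gen_eigenspace M z = {w. ((\<lambda>w. M *v w - z *s w) ^^ CARD('n)) w = 0}"

text \<open>Sum of the real generalized eigenspaces of the linear map L for eigenvalues of modulus 1
  (= real vectors lying in the sum of the complex generalized eigenspaces for |z| = 1).\<close>
definition center_subspace :: "(real^'n \<Rightarrow> real^'n) \<Rightarrow> (real^'n::finite) set" where
  "center_subspace L = {v. complexify_vec v \<in>
      span (\<Union>z\<in>{z. cmod z = 1}. gen_eigenspace (complexify_mat (matrix L)) z)}"

primrec traj :: "('g \<Rightarrow> 'u \<Rightarrow> 'g) \<Rightarrow> nat \<Rightarrow> 'g \<Rightarrow> (nat \<Rightarrow> 'u) \<Rightarrow> 'g" where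
  "traj f 0 g u = g"
| "traj f (Suc k) g u = f (traj f k g u) (u k)"

definition reachable_set :: "('g \<Rightarrow> 'u \<Rightarrow> 'g) \<Rightarrow> 'u set \<Rightarrow> 'g \<Rightarrow> 'g set" where
  "reachable_set f U e = {traj f k e u | k u. k \<ge> 1 \<and> (\<forall>i. u i \<in> U)}"

definition controllable_set :: "('g \<Rightarrow> 'u \<Rightarrow> 'g) \<Rightarrow> 'u set \<Rightarrow> 'g \<Rightarrow> 'g set" where
  "controllable_set f U e = {g. \<exists>k u. k \<ge> 1 \<and> (\<forall>i. u i \<in> U) \<and> traj f k g u = e}"

definition controllable :: "('g \<Rightarrow> 'u \<Rightarrow> 'g) \<Rightarrow> 'u set \<Rightarrow> bool" where
  "controllable f U \<longleftrightarrow> (\<forall>g h. \<exists>k u. (\<forall>i. u i \<in> U) \<and> traj f k g u = h)"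

definition linear_system ::
  "('g::topological_space, 'b) monoid_scheme \<Rightarrow> ('g, 'n::finite) chart set \<Rightarrow>
   ('g \<Rightarrow> real^'m \<Rightarrow> 'g) \<Rightarrow> (real^'m::finite) set \<Rightarrow> bool" where
  "linear_system G A f U \<longleftrightarrow> compact U \<and> 0 \<in> interior U \<and>
     lie_automorphism G A (\<lambda>g. f g 0) \<and>
     (\<forall>u\<in>U. \<forall>g. f g u = f \<one>\<^bsub>G\<^esub> u \<otimes>\<^bsub>G\<^esub> f g 0)"

text \<open>g^0 = g: the centre subspace of df_0 = d(f_0)_e (computed in a chart around e)
  is the whole Lie algebra.\<close>
definition center_full ::
  "('g::topological_space, 'b) monoid_scheme \<Rightarrow> ('g, 'n::finite) chart set \<Rightarrow> ('g \<Rightarrow> 'g) \<Rightarrow> bool" where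
  "center_full G A f0 \<longleftrightarrow> (\<exists>(U, \<phi>, \<psi>)\<in>A. \<exists>L. \<one>\<^bsub>G\<^esub> \<in> U \<and>
      ((\<lambda>x. \<phi> (f0 (\<psi> x))) has_derivative L) (at (\<phi> \<one>\<^bsub>G\<^esub>)) \<and>
      center_subspace L = UNIV)"

end

theory Submission
  imports Defs
begin

text \<open>
  Write h for the automorphism \<open>f\<^sub>0\<close>. The reachable set R is open, contains 1, satisfies \<open>h R \<subseteq> R\<close>, and for
  every x in R there is k with \<open>x h\<^sup>k(R) \<subseteq> R\<close>. The controllable set has the same properties with respect to
  \<open>h\<^sup>-\<^sup>1\<close>, whose differential again has spectrum on the unit circle, so it suffices to show R = G.

  The core \<open>W = \<Inter>\<^sub>m h\<^sup>m(R)\<close> is an h-invariant semigroup with \<open>R W \<subseteq> R\<close>, and its group part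
  \<open>H = W \<inter> W\<^sup>-\<^sup>1\<close> is a closed h-invariant subgroup. By descending induction H contains the closure E of
  every derived subgroup: if \<open>[E, E] \<subseteq> H\<close> but not \<open>E \<subseteq> H\<close>, then some plane or line spanned by the real and
  imaginary parts of an eigenvector of dh in \<open>T E\<close> modulo \<open>T (E \<inter> H)\<close> is not tangent to H. On it dh is a rotation,
  so a small disc in it stays small under all iterates of dh. Its exponential therefore lies in \<open>h\<^sup>m(R)\<close>
  for all m, hence in H, a contradiction.

  The exponential map is obtained from \<open>exp X = lim (\<psi> (X / n))\<^sup>n\<close> in a chart, without solving
  differential equations: \<open>a\<^sub>k\<^bsup>n\<^sub>k\<^esup> \<rightarrow> exp X\<close> whenever \<open>a\<^sub>k \<rightarrow> 1\<close> and \<open>n\<^sub>k \<phi>(a\<^sub>k) \<rightarrow> X\<close>.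
\<close>

section \<open>Second-order estimates for smooth maps\<close>

text \<open>Two obstacles shape the argument. Jordan blocks with eigenvalues on the unit circle let
  vectors grow polynomially, so the orbit of a small vector under dh need not stay small. A genuine
  eigenvector is therefore taken modulo the tangent vectors already known to belong to H, where dh
  acts as a rotation. Such a factor is absorbed because every image of R under a power of h is
  stable under right multiplication by W. Closures are taken because derived subgroups may fail to
  be closed, whereas tangent spaces are well behaved for closed subgroups; commutator relations pass
  to closures by continuity.

  The entry above contains a malformed symbol and is withdrawn; the complete list follows and
  replaces it.\<close>

lemma smooth_on_lipschitz_derivative:
  fixes f :: "'a::euclidean_space \<Rightarrow> 'b::euclidean_space"
  assumes sm: "smooth_on S f" and z: "z \<in> S"
  obtains f' r C where "r > 0" "C \<ge> 0" "cball z r \<subseteq> S"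
    "\<And>x. x \<in> cball z r \<Longrightarrow> (f has_derivative f' x) (at x)"
    "\<And>x y v. x \<in> cball z r \<Longrightarrow> y \<in> cball z r \<Longrightarrow>
        norm (f' x v - f' y v) \<le> C * norm (x - y) * norm v"
proof -
  from sm obtain D :: "'a list \<Rightarrow> 'a \<Rightarrow> 'b" where S: "open S"
    and D0: "\<And>x. x \<in> S \<Longrightarrow> D [] x = f x"
    and D: "\<And>vs x. x \<in> S \<Longrightarrow> ((D vs) has_derivative (\<lambda>v. D (v # vs) x)) (at x)"
    unfolding smooth_on_def by blast
  obtain r where r: "r > 0" "cball z r \<subseteq> S"
    using S z open_contains_cball by blast
  have df: "(f has_derivative (\<lambda>v. D [v] x)) (at x)" if "x \<in> S" for x
    using D[OF that, of "[]"] by (rule has_derivative_transform_within_open[OF _ S that]) (rule D0)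
  \<comment> \<open>Compactness bounds \<open>D [c, b]\<close> for fixed directions. The basis is
    finite, and linearity in the head of the list extends the bound to every head direction.\<close>
  have "\<exists>K. \<forall>x\<in>cball z r. norm (D [c, b] x) \<le> K" for b c
  proof -
    have "continuous_on (cball z r) (D [c, b])"
      using D r by (intro continuous_at_imp_continuous_on) (auto intro: has_derivative_continuous)
    then have "compact (D [c, b] ` cball z r)"
      by (intro compact_continuous_image) auto
    then show ?thesis
      by (auto dest!: compact_imp_bounded simp: bounded_iff)
  qed
  then have "\<exists>K. \<forall>b c. \<forall>x\<in>cball z r. norm (D [c, b] x) \<le> K b c"
    by (intro choice allI)
  then obtain K where K: "\<And>b c x. x \<in> cball z r \<Longrightarrow> norm (D [c, b] x) \<le> K b c"
    by blast
  define L where "L b = (\<Sum>c\<in>Basis. K b c)" for b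
  have zr: "z \<in> cball z r" using r by simp
  have K0: "K b c \<ge> 0" for b c by (rule order_trans[OF norm_ge_zero K[OF zr]])
  have L0: "L b \<ge> 0" for b unfolding L_def by (simp add: K0 sum_nonneg)
  have lin: "linear (\<lambda>v. D (v # vs) x)" if "x \<in> S" for vs x
    using D[OF that] has_derivative_linear by blast
  have expand: "D (w # vs) x = (\<Sum>c\<in>Basis. (w \<bullet> c) *\<^sub>R D (c # vs) x)" if "x \<in> S" for w vs x
  proof -
    have "D (w # vs) x = D ((\<Sum>c\<in>Basis. (w \<bullet> c) *\<^sub>R c) # vs) x" by (simp add: euclidean_representation)
    also have "\<dots> = (\<Sum>c\<in>Basis. (w \<bullet> c) *\<^sub>R D (c # vs) x)"
      by (simp add: linear_sum[OF lin[OF that]] linear_cmul[OF lin[OF that]])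
    finally show ?thesis .
  qed
  have bd: "norm (D [w, b] x) \<le> L b * norm w" if "x \<in> cball z r" for b w x
  proof -
    have "x \<in> S" using that r by auto
    from expand[OF this, of w "[b]"]
    have "norm (D [w, b] x) = norm (\<Sum>c\<in>Basis. (w \<bullet> c) *\<^sub>R D [c, b] x)"
      by (rule arg_cong)
    also have "\<dots> \<le> (\<Sum>c\<in>Basis. norm ((w \<bullet> c) *\<^sub>R D [c, b] x))"
      by (rule norm_sum)
    also have "\<dots> \<le> (\<Sum>c\<in>Basis. norm w * K b c)"
      by (intro sum_mono) (auto intro!: mult_mono Basis_le_norm K that)
    finally show ?thesis by (simp add: L_def sum_distrib_left mult.commute)
  qed
  have lip: "norm (D [b] x - D [b] y) \<le> L b * norm (x - y)"
    if "x \<in> cball z r" "y \<in> cball z r" for b x y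
  proof (rule differentiable_bound[of "cball z r" "D [b]" "\<lambda>x v. D [v, b] x"])
    show "(D [b] has_derivative (\<lambda>v. D [v, b] x)) (at x within cball z r)" if "x \<in> cball z r" for x
      using D that r by (auto intro!: has_derivative_at_withinI[OF D])
    show "onorm (\<lambda>v. D [v, b] x) \<le> L b" if "x \<in> cball z r" for x
      by (rule onorm_le) (use bd that in \<open>auto simp: mult.commute\<close>)
  qed (use that in auto)
  define C where "C = (\<Sum>b\<in>Basis. L b)"
  have "norm (D [v] x - D [v] y) \<le> C * norm (x - y) * norm v"
    if "x \<in> cball z r" "y \<in> cball z r" for x y v
  proof -
    have "D [v] x - D [v] y = (\<Sum>b\<in>Basis. (v \<bullet> b) *\<^sub>R (D [b] x - D [b] y))"
      using expand[of x v "[]"] expand[of y v "[]"] that r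
      by (auto simp: sum_subtractf scaleR_diff_right subset_iff)
    also have "norm \<dots> \<le> (\<Sum>b\<in>Basis. norm ((v \<bullet> b) *\<^sub>R (D [b] x - D [b] y)))"
      by (rule norm_sum)
    also have "\<dots> \<le> (\<Sum>b\<in>Basis. norm v * (L b * norm (x - y)))"
      by (intro sum_mono) (auto intro!: mult_mono Basis_le_norm lip that)
    finally show ?thesis by (simp add: C_def sum_distrib_left sum_distrib_right mult_ac)
  qed
  moreover have "C \<ge> 0" unfolding C_def by (simp add: L0 sum_nonneg)
  ultimately show ?thesis
    using r df by (intro that[of r C "\<lambda>x v. D [v] x"]) auto
qed

text \<open>For fixed x and x' the function m x y - m x' y has a y-derivative of size C * norm (x -
  x'), by the Lipschitz bound on the derivative of m; the mean value inequality in y supplies the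
  other factor. With one argument at the identity this compares the group product with
  addition.\<close>

lemma second_difference_estimate:
  fixes m :: "'u::euclidean_space \<Rightarrow> 'v::euclidean_space \<Rightarrow> 'w::euclidean_space"
  assumes sm: "smooth_on S (\<lambda>(x, y). m x y)" and S: "(a, b) \<in> S"
  obtains r C where "r > 0" "C \<ge> 0" "ball a r \<times> ball b r \<subseteq> S"
    "\<And>x x' y y'. x \<in> ball a r \<Longrightarrow> x' \<in> ball a r \<Longrightarrow> y \<in> ball b r \<Longrightarrow> y' \<in> ball b r \<Longrightarrow>
       norm (m x y - m x' y - (m x y' - m x' y')) \<le> C * norm (x - x') * norm (y - y')"
proof -
  obtain M R C where R: "R > 0" "C \<ge> 0" "cball (a, b) R \<subseteq> S"
    and dm: "\<And>p. p \<in> cball (a, b) R \<Longrightarrow> ((\<lambda>(x, y). m x y) has_derivative M p) (at p)"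
    and lip: "\<And>p q v. p \<in> cball (a, b) R \<Longrightarrow> q \<in> cball (a, b) R \<Longrightarrow>
        norm (M p v - M q v) \<le> C * norm (p - q) * norm v"
    by (rule smooth_on_lipschitz_derivative[OF sm S]) (rule that; assumption)
  have in_ball: "(x, y) \<in> cball (a, b) R" if "x \<in> ball a (R/2)" "y \<in> ball b (R/2)" for x y
    using norm_Pair_le[of "a - x" "b - y"] that by (simp add: dist_norm)
  have "norm (m x y - m x' y - (m x y' - m x' y')) \<le> C * norm (x - x') * norm (y - y')"
    if h: "x \<in> ball a (R/2)" "x' \<in> ball a (R/2)" "y \<in> ball b (R/2)" "y' \<in> ball b (R/2)" for x x' y y'
  proof -
    define g where "g = (\<lambda>y. m x y - m x' y)"
    have part: "((\<lambda>y. m x y) has_derivative (\<lambda>v. M (x, y) (0, v))) (at y within ball b (R/2))"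
      if "x \<in> ball a (R/2)" "y \<in> ball b (R/2)" for x y
    proof -
      have "((\<lambda>y. (x, y)) has_derivative (\<lambda>v. (0, v))) (at y within ball b (R/2))"
        by (auto intro!: derivative_eq_intros)
      from has_derivative_compose[OF this dm[OF in_ball[OF that]]] show ?thesis by simp
    qed
    have "norm (g y - g y') \<le> (C * norm (x - x')) * norm (y - y')"
    proof (rule differentiable_bound[of "ball b (R/2)" g "\<lambda>y v. M (x, y) (0, v) - M (x', y) (0, v)"])
      show "(g has_derivative (\<lambda>v. M (x, y) (0, v) - M (x', y) (0, v))) (at y within ball b (R/2))"
        if "y \<in> ball b (R/2)" for y
        unfolding g_def using part h that by (auto intro!: has_derivative_diff)
      show "onorm (\<lambda>v. M (x, y) (0, v) - M (x', y) (0, v)) \<le> C * norm (x - x')"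
        if "y \<in> ball b (R/2)" for y
      proof (rule onorm_le)
        fix v :: 'v
        show "norm (M (x, y) (0, v) - M (x', y) (0, v)) \<le> C * norm (x - x') * norm v"
          using lip[OF in_ball in_ball, of x y x' y "(0, v)"] h that by (simp add: norm_Pair)
      qed
    qed (use h in auto)
    then show ?thesis by (simp add: g_def)
  qed
  moreover have "ball a (R/2) \<times> ball b (R/2) \<subseteq> S" using in_ball R by auto
  ultimately show ?thesis using that[of "R/2" C] R by auto
qed

section \<open>The exponential map in group coordinates\<close>

locale topological_group = group G for G :: "('g::t2_space, 'b) monoid_scheme" (structure) +
  assumes carrier_UNIV [simp]: "carrier G = UNIV"
    and continuous_mult: "continuous_on UNIV (\<lambda>(x, y). x \<otimes> y)"
    and continuous_inv: "continuous_on UNIV (\<lambda>x. inv x)"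
begin

lemma tendsto_mult_group:
  assumes "(a \<longlongrightarrow> x) F" "(b \<longlongrightarrow> y) F"
  shows "((\<lambda>k. a k \<otimes> b k) \<longlongrightarrow> x \<otimes> y) F"
  using continuous_on_tendsto_compose[OF continuous_mult tendsto_Pair[OF assms]] by simp

lemma tendsto_inv_group:
  assumes "(a \<longlongrightarrow> x) F"
  shows "((\<lambda>k. inv (a k)) \<longlongrightarrow> inv x) F"
  using continuous_on_tendsto_compose[OF continuous_inv assms] by simp

lemma tendsto_pow_group:
  assumes "(a \<longlongrightarrow> x) F"
  shows "((\<lambda>k. a k [^] (n::nat)) \<longlongrightarrow> x [^] n) F"
  by (induction n) (auto intro: tendsto_mult_group assms)

lemma continuous_on_mult_group:
  assumes "continuous_on S a" "continuous_on S b"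
  shows "continuous_on S (\<lambda>k. a k \<otimes> b k)"
  using assms unfolding continuous_on_def by (blast intro: tendsto_mult_group)

lemma continuous_on_inv_group:
  assumes "continuous_on S a"
  shows "continuous_on S (\<lambda>k. inv (a k))"
  using assms unfolding continuous_on_def by (blast intro: tendsto_inv_group)

end

text \<open>The chart is translated so that the identity has coordinate 0. Both difference estimates
  are mixed second differences of the product with one corner at the identity: multiplication by a
  small element distorts differences by a small relative amount.\<close>

locale lie_coordinates = topological_group G for G :: "('g::t2_space, 'b) monoid_scheme" (structure) +
  fixes phi :: "'g \<Rightarrow> 'v::euclidean_space" and psi :: "'v \<Rightarrow> 'g" and V :: "'g set" and r C :: real
  assumes open_V: "open V" and one_V: "\<one> \<in> V" and phi_one: "phi \<one> = 0"
    and continuous_phi: "continuous_on V phi" and continuous_psi: "continuous_on (ball 0 r) psi"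
    and r_pos: "r > 0" and C_pos: "C > 0"
    and psi_V: "\<And>x. norm x < r \<Longrightarrow> psi x \<in> V"
    and phi_psi: "\<And>x. norm x < r \<Longrightarrow> phi (psi x) = x"
    and psi_phi: "\<And>g. g \<in> V \<Longrightarrow> psi (phi g) = g"
    and mult_V: "\<And>x y. norm x < r \<Longrightarrow> norm y < r \<Longrightarrow> psi x \<otimes> psi y \<in> V"
    and mult_diff_left: "\<And>x x' y. norm x < r \<Longrightarrow> norm x' < r \<Longrightarrow> norm y < r \<Longrightarrow>
       norm (phi (psi x \<otimes> psi y) - phi (psi x' \<otimes> psi y) - (x - x')) \<le> C * norm y * norm (x - x')"
    and mult_diff_right: "\<And>x y y'. norm x < r \<Longrightarrow> norm y < r \<Longrightarrow> norm y' < r \<Longrightarrow>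
       norm (phi (psi x \<otimes> psi y) - phi (psi x \<otimes> psi y') - (y - y')) \<le> C * norm x * norm (y - y')"
begin

section \<open>Powers of small group elements in coordinates\<close>

lemma psi_zero: "psi 0 = \<one>"
  using psi_phi[OF one_V] by (simp add: phi_one)

lemma mult_approx:
  assumes "norm x < r" "norm y < r"
  shows "norm (phi (psi x \<otimes> psi y) - x - y) \<le> C * norm x * norm y"
proof -
  have "psi 0 \<otimes> psi y = psi y" by (simp add: psi_zero)
  then show ?thesis
    using mult_diff_left[of x 0 y] assms r_pos by (simp add: phi_psi algebra_simps)
qed

text \<open>The bound r / 4 keeps powers, whose coordinates have norm at most 2 * \<open>r0\<close>,
  inside the chart ball. The other bound gives 4 * C * \<open>r0\<close> \<le> 1, which closes the
  induction in \<open>pow_diff\<close>.\<close>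

definition r0 :: real where "r0 = min (r / 4) (1 / (4 * C))"

lemma r0: "r0 > 0" "4 * r0 \<le> r" "C * r0 \<le> 1 / 4"
proof -
  show "r0 > 0" "4 * r0 \<le> r" using r_pos C_pos by (auto simp: r0_def)
  have "C * r0 \<le> C * (1 / (4 * C))" unfolding r0_def using C_pos by (intro mult_left_mono) auto
  also have "\<dots> = 1 / 4" using C_pos by simp
  finally show "C * r0 \<le> 1 / 4" .
qed

text \<open>Each further factor adds norm x and an error C * norm p * norm x; since C * norm p \<le>
  1, the growth per step is at most 2 * norm x.\<close>

lemma pow_bound:
  assumes "real n * norm x \<le> r0" "j \<le> n"
  shows "psi x [^] j \<in> V \<and> norm (phi (psi x [^] j)) \<le> 2 * real j * norm x"
  using assms(2)
proof (induction j)
  case 0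
  then show ?case by (simp add: one_V phi_one)
next
  case (Suc j)
  define p where "p = phi (psi x [^] j)"
  have p: "psi p = psi x [^] j" "norm p \<le> 2 * real j * norm x"
    using Suc by (auto simp: p_def psi_phi)
  have jn: "real j * norm x \<le> r0"
    using Suc.prems assms(1) by (intro order_trans[OF mult_right_mono[of "real j" "real n"]]) auto
  have "1 * norm x \<le> real n * norm x" using Suc.prems by (intro mult_right_mono) auto
  then have x: "norm x < r" using assms(1) r0 by linarith
  have pr: "norm p \<le> 2 * r0" using p(2) jn by linarith
  then have pr': "norm p < r" using r0 by linarith
  have "norm (phi (psi p \<otimes> psi x) - p - x) \<le> (C * norm p) * norm x"
    using mult_approx[OF pr' x] by simp
  also have "\<dots> \<le> 1 * norm x"
  proof (rule mult_right_mono)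
    have "C * norm p \<le> C * (2 * r0)" using pr C_pos by (intro mult_left_mono) auto
    then show "C * norm p \<le> 1" using r0(3) by linarith
  qed auto
  finally have "norm (phi (psi p \<otimes> psi x) - p - x) \<le> norm x" by simp
  moreover have "phi (psi p \<otimes> psi x) = (phi (psi p \<otimes> psi x) - p - x) + p + x" by simp
  ultimately have "norm (phi (psi p \<otimes> psi x)) \<le> norm x + norm p + norm x"
    by (smt (verit) norm_triangle_ineq)
  also have "\<dots> \<le> 2 * real (Suc j) * norm x" using p(2) by (simp add: algebra_simps)
  finally show ?case using mult_V[OF pr' x] by (simp add: p(1))
qed

lemma pow_phi:
  assumes "real n * norm x \<le> r0" "j \<le> n"
  shows "psi (phi (psi x [^] j)) = psi x [^] j" "norm (phi (psi x [^] j)) < r"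
    "norm (phi (psi x [^] j)) \<le> 2 * r0"
proof -
  have jn: "real j * norm x \<le> r0"
    using assms by (intro order_trans[OF mult_right_mono[of "real j" "real n"]]) auto
  show "psi (phi (psi x [^] j)) = psi x [^] j"
    using pow_bound[OF assms] psi_phi by blast
  show "norm (phi (psi x [^] j)) \<le> 2 * r0"
    using pow_bound[OF assms] jn by linarith
  then show "norm (phi (psi x [^] j)) < r" using r0 by linarith
qed

lemma small_if_pow_small:
  assumes "real n * norm x \<le> r0" "Suc j \<le> n"
  shows "norm x < r" "norm x \<le> r0"
proof -
  have "1 * norm x \<le> real n * norm x" using assms(2) by (intro mult_right_mono) auto
  then show "norm x \<le> r0" using assms(1) by linarith
  then show "norm x < r" using r0 by linarith
qed

text \<open>Step j adds an error of at most 2 * C * j times the square of norm x, and j + j^2 \<le>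
  (j + 1)^2 sums these up.\<close>

lemma pow_approx:
  assumes "real n * norm x \<le> r0" "j \<le> n"
  shows "norm (phi (psi x [^] j) - real j *\<^sub>R x) \<le> 2 * C * (real j * norm x)\<^sup>2"
  using assms(2)
proof (induction j)
  case 0
  then show ?case by (simp add: phi_one)
next
  case (Suc j)
  define p where "p = phi (psi x [^] j)"
  have j: "j \<le> n" using Suc by simp
  note p = pow_phi[OF assms(1) j, folded p_def]
  have p2: "norm p \<le> 2 * real j * norm x" using pow_bound[OF assms(1) j] by (simp add: p_def)
  note x = small_if_pow_small[OF assms(1) Suc.prems]
  have "norm (phi (psi p \<otimes> psi x) - p - x) \<le> C * norm p * norm x"
    using mult_approx[OF p(2) x(1)] by simp
  also have "\<dots> \<le> C * (2 * real j * norm x) * norm x"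
    using p2 C_pos by (intro mult_right_mono mult_left_mono) auto
  finally have "norm (phi (psi p \<otimes> psi x) - p - x) \<le> 2 * C * real j * (norm x)\<^sup>2"
    by (simp add: power2_eq_square mult_ac)
  moreover have "norm (p - real j *\<^sub>R x) \<le> 2 * C * (real j * norm x)\<^sup>2"
    using Suc j by (simp add: p_def)
  moreover have "phi (psi p \<otimes> psi x) - real (Suc j) *\<^sub>R x
      = (phi (psi p \<otimes> psi x) - p - x) + (p - real j *\<^sub>R x)" by (simp add: algebra_simps)
  ultimately have "norm (phi (psi p \<otimes> psi x) - real (Suc j) *\<^sub>R x)
      \<le> 2 * C * real j * (norm x)\<^sup>2 + 2 * C * (real j * norm x)\<^sup>2"
    by (smt (verit) norm_triangle_ineq)
  also have "\<dots> = 2 * C * (norm x)\<^sup>2 * (real j * (real j + 1))"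
    by (simp add: power2_eq_square algebra_simps)
  also have "\<dots> \<le> 2 * C * (norm x)\<^sup>2 * (real (Suc j) * real (Suc j))"
    using C_pos by (intro mult_left_mono mult_mono) auto
  finally show ?case by (simp add: p(1) power2_eq_square mult_ac)
qed

text \<open>One more factor changes the difference p - q by at most 3 * norm (x - y): norm (x - y)
  for the new factor itself, and one product error of that size for each argument that
  varies.\<close>

lemma pow_diff:
  assumes x: "real n * norm x \<le> r0" and y: "real n * norm y \<le> r0" and "j \<le> n"
  shows "norm (phi (psi x [^] j) - phi (psi y [^] j)) \<le> 4 * real j * norm (x - y)"
  using assms(3)
proof (induction j)
  case 0
  then show ?case by simp
next
  case (Suc j)
  define p where "p = phi (psi x [^] j)"
  define q where "q = phi (psi y [^] j)"
  have j: "j \<le> n" using Suc by simp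
  note p = pow_phi[OF x j, folded p_def]
  note q = pow_phi[OF y j, folded q_def]
  note xr = small_if_pow_small[OF x Suc.prems]
  note yr = small_if_pow_small[OF y Suc.prems]
  have IH: "norm (p - q) \<le> 4 * real j * norm (x - y)" using Suc j by (simp add: p_def q_def)
  have jn: "real j * norm x \<le> r0"
    using x j by (intro order_trans[OF mult_right_mono[of "real j" "real n"]]) auto
  have "norm (phi (psi p \<otimes> psi x) - phi (psi q \<otimes> psi x) - (p - q)) \<le> C * norm x * norm (p - q)"
    using mult_diff_left p q xr by blast
  also have "\<dots> \<le> C * norm x * (4 * real j * norm (x - y))"
    using IH C_pos by (intro mult_left_mono) auto
  also have "\<dots> = 4 * (C * (real j * norm x)) * norm (x - y)" by simp
  also have "\<dots> \<le> 4 * (C * r0) * norm (x - y)"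
    using jn C_pos by (intro mult_right_mono mult_left_mono) auto
  also have "\<dots> \<le> 4 * (1/4) * norm (x - y)"
    using r0 by (intro mult_right_mono mult_left_mono) auto
  finally have 1: "norm (phi (psi p \<otimes> psi x) - phi (psi q \<otimes> psi x) - (p - q)) \<le> norm (x - y)"
    by simp
  have "norm (phi (psi q \<otimes> psi x) - phi (psi q \<otimes> psi y) - (x - y)) \<le> C * norm q * norm (x - y)"
    using mult_diff_right q xr yr by blast
  also have "\<dots> \<le> C * (2 * r0) * norm (x - y)"
    using q C_pos by (intro mult_right_mono mult_left_mono) auto
  also have "\<dots> \<le> 1 * norm (x - y)"
    using r0 by (intro mult_right_mono) auto
  finally have 2: "norm (phi (psi q \<otimes> psi x) - phi (psi q \<otimes> psi y) - (x - y)) \<le> norm (x - y)"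
    by simp
  have "phi (psi p \<otimes> psi x) - phi (psi q \<otimes> psi y) =
      (phi (psi p \<otimes> psi x) - phi (psi q \<otimes> psi x) - (p - q)) +
      (phi (psi q \<otimes> psi x) - phi (psi q \<otimes> psi y) - (x - y)) + ((p - q) + (x - y))" by simp
  then have "norm (phi (psi p \<otimes> psi x) - phi (psi q \<otimes> psi y)) \<le>
     norm (x - y) + norm (x - y) + (norm (p - q) + norm (x - y))"
    using 1 2 norm_triangle_ineq by (smt (verit))
  also have "\<dots> \<le> 4 * real j * norm (x - y) + 4 * norm (x - y)"
    using IH norm_ge_zero[of "x - y"] by linarith
  also have "\<dots> = 4 * real (Suc j) * norm (x - y)"
    by (simp add: algebra_simps)
  finally show ?case by (simp add: p(1) q(1))
qed

section \<open>Existence and estimates of the local exponential\<close>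

definition local_exp :: "'v \<Rightarrow> 'v" where
  "local_exp X = lim (\<lambda>n. phi (psi ((1 / real n) *\<^sub>R X) [^] n))"

text \<open>The m-th power of psi (X / (m n)) is psi w with w within 2 C (norm X / n)^2 of X / n, by
  \<open>pow_approx\<close>; raising to the n-th power enlarges this distance by a factor of at most
  4 n, by \<open>pow_diff\<close>. Half of \<open>r0\<close> appears because w may be twice as long
  as X / n.\<close>

lemma pow_refine:
  assumes X: "norm X \<le> r0 / 2" and n: "n > 0" and m: "m > 0"
  shows "norm (phi (psi ((1 / real n) *\<^sub>R X) [^] n) -
    phi (psi ((1 / real (m * n)) *\<^sub>R X) [^] (m * n))) \<le> 8 * C * (norm X)\<^sup>2 / real n"
proof -
  define z where "z = (1 / real (m * n)) *\<^sub>R X"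
  define w where "w = phi (psi z [^] m)"
  have r0_half: "r0 / 2 \<le> r0" using r0 by simp
  have mz: "real m * norm z = norm X / real n" using m n by (simp add: z_def)
  also have "\<dots> \<le> norm X" using n by (simp add: divide_le_eq mult_le_cancel_left1)
  finally have mz': "real m * norm z \<le> r0" using X r0_half by linarith
  have w: "psi w = psi z [^] m" "norm w \<le> 2 * real m * norm z"
    "norm (w - real m *\<^sub>R z) \<le> 2 * C * (real m * norm z)\<^sup>2"
    using pow_phi[OF mz' order_refl] pow_bound[OF mz' order_refl] pow_approx[OF mz' order_refl]
    by (auto simp: w_def)
  have "real n * norm w \<le> real n * (2 * (norm X / real n))"
    using w(2) mz n by (intro mult_left_mono) auto
  then have nw: "real n * norm w \<le> r0" using X n by simp
  have nX: "real n * norm ((1 / real n) *\<^sub>R X) \<le> r0" using X n r0_half by simp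
  have mz2: "real m *\<^sub>R z = (1 / real n) *\<^sub>R X" using m n by (simp add: z_def)
  have "norm (phi (psi ((1 / real n) *\<^sub>R X) [^] n) - phi (psi w [^] n)) \<le>
      4 * real n * norm ((1 / real n) *\<^sub>R X - w)"
    by (rule pow_diff[OF nX nw order_refl])
  also have "\<dots> \<le> 4 * real n * (2 * C * (norm X / real n)\<^sup>2)"
    using w(3) n by (intro mult_left_mono) (auto simp: mz2 mz norm_minus_commute)
  also have "\<dots> = 8 * C * (norm X)\<^sup>2 / real n" using n by (simp add: power2_eq_square field_simps)
  also have "psi w [^] n = psi z [^] (m * n)" by (simp add: w(1) nat_pow_pow)
  finally show ?thesis by (simp add: z_def)
qed

lemma local_exp_limit:
  assumes X: "norm X \<le> r0 / 2"
  shows "(\<lambda>n. phi (psi ((1 / real n) *\<^sub>R X) [^] n)) \<longlonglongrightarrow> local_exp X"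
proof -
  define c where "c n = phi (psi ((1 / real n) *\<^sub>R X) [^] n)" for n
  define K where "K = 8 * C * (norm X)\<^sup>2"
  have K: "K \<ge> 0" using C_pos by (simp add: K_def)
  have step: "norm (c n - c (m * n)) \<le> K / real n" if "n > 0" "m > 0" for n m
    using pow_refine[OF X that] by (simp add: c_def K_def)
  have "Cauchy c"
  proof (rule CauchyI)
    fix e :: real assume e: "e > 0"
    obtain N where N: "real N > 2 * K / e" using reals_Archimedean2 by blast
    have bd: "K / real n < e / 2" if "n \<ge> Suc N" for n
    proof -
      have "2 * K / e < real n" using N that by linarith
      then show ?thesis using e that by (simp add: field_simps)
    qed
    \<comment> \<open>Both terms are compared with their common refinement c (m n).\<close>
    have "norm (c m - c n) < e" if mn: "m \<ge> Suc N" "n \<ge> Suc N" for m n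
    proof -
      have "norm (c m - c (n * m)) < e / 2" "norm (c n - c (m * n)) < e / 2"
        using step[of m n] step[of n m] bd[OF mn(1)] bd[OF mn(2)] mn by linarith+
      then have "norm ((c m - c (n * m)) - (c n - c (m * n))) < e"
        using norm_triangle_ineq4[of "c m - c (n * m)" "c n - c (m * n)"] by linarith
      then show ?thesis by (simp add: mult.commute)
    qed
    then show "\<exists>M. \<forall>m\<ge>M. \<forall>n\<ge>M. norm (c m - c n) < e" by blast
  qed
  then show ?thesis
    unfolding local_exp_def c_def[symmetric]
    by (simp add: Cauchy_convergent_iff convergent_LIMSEQ_iff)
qed

lemma local_exp_approx:
  assumes X: "norm X \<le> r0 / 2"
  shows "norm (local_exp X - X) \<le> 2 * C * (norm X)\<^sup>2"
proof (rule tendsto_upperbound[OF tendsto_norm[OF tendsto_diff[OF local_exp_limit[OF X] tendsto_const]]])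
  show "\<forall>\<^sub>F n in sequentially.
     norm (phi (psi ((1 / real n) *\<^sub>R X) [^] n) - X) \<le> 2 * C * (norm X)\<^sup>2"
  proof (rule eventually_sequentiallyI[of 1])
    fix n :: nat assume n: "1 \<le> n"
    then have "real n * norm ((1 / real n) *\<^sub>R X) \<le> r0" using X r0(1) by simp
    from pow_approx[OF this order_refl] n
    show "norm (phi (psi ((1 / real n) *\<^sub>R X) [^] n) - X) \<le> 2 * C * (norm X)\<^sup>2" by simp
  qed
qed simp

lemma local_exp_lipschitz:
  assumes X: "norm X \<le> r0 / 2" and Y: "norm Y \<le> r0 / 2"
  shows "norm (local_exp X - local_exp Y) \<le> 4 * norm (X - Y)"
proof (rule tendsto_upperbound[OF tendsto_norm[OF tendsto_diff[OF local_exp_limit[OF X] local_exp_limit[OF Y]]]])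
  show "\<forall>\<^sub>F n in sequentially.
     norm (phi (psi ((1 / real n) *\<^sub>R X) [^] n) - phi (psi ((1 / real n) *\<^sub>R Y) [^] n)) \<le> 4 * norm (X - Y)"
  proof (rule eventually_sequentiallyI[of 1])
    fix n :: nat assume n: "1 \<le> n"
    then have "real n * norm ((1 / real n) *\<^sub>R X) \<le> r0" "real n * norm ((1 / real n) *\<^sub>R Y) \<le> r0"
      using X Y r0(1) by auto
    from pow_diff[OF this order_refl] n
    show "norm (phi (psi ((1 / real n) *\<^sub>R X) [^] n) - phi (psi ((1 / real n) *\<^sub>R Y) [^] n)) \<le> 4 * norm (X - Y)"
      by (simp add: scaleR_diff_right[symmetric])
  qed
qed simp

lemma local_exp_zero: "local_exp 0 = 0"
  using local_exp_approx[of 0] r0(1) by simp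

lemma local_exp_small:
  assumes X: "norm X \<le> r0 / 2"
  shows "norm (local_exp X) < r"
  using local_exp_lipschitz[OF X, of 0] X r0 by (simp add: local_exp_zero)

text \<open>This is \<open>pow_refine\<close> for X = n x with m tending to infinity. The final
  factor norm x makes the error vanish when x tends to 0 while n x stays bounded.\<close>

lemma pow_local_exp:
  assumes x: "real n * norm x \<le> r0 / 2"
  shows "norm (phi (psi x [^] n) - local_exp (real n *\<^sub>R x)) \<le> 8 * C * (real n * norm x) * norm x"
proof (cases "n = 0")
  case True
  then show ?thesis by (simp add: phi_one local_exp_zero)
next
  case False
  define X where "X = real n *\<^sub>R x"
  have X: "norm X \<le> r0 / 2" using x by (simp add: X_def)
  have "filterlim (\<lambda>m. m * n) at_top sequentially"
    using False by (intro filterlim_subseq) (auto simp: strict_mono_def)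
  from filterlim_compose[OF local_exp_limit[OF X] this]
  have lim: "(\<lambda>m. phi (psi ((1 / real (m * n)) *\<^sub>R X) [^] (m * n))) \<longlonglongrightarrow> local_exp X" .
  have "norm (phi (psi ((1 / real n) *\<^sub>R X) [^] n) - local_exp X) \<le> 8 * C * (norm X)\<^sup>2 / real n"
    by (rule tendsto_upperbound[OF tendsto_norm[OF tendsto_diff[OF tendsto_const lim]]])
      (use pow_refine[OF X] False in \<open>auto intro!: eventually_sequentiallyI[of 1]\<close>)
  also have "8 * C * (norm X)\<^sup>2 / real n = 8 * C * (real n * norm x) * norm x"
    using False by (simp add: X_def power2_eq_square field_simps)
  also have "(1 / real n) *\<^sub>R X = x" using False by (simp add: X_def)
  finally show ?thesis by (simp add: X_def)
qed

section \<open>Limits of powers and the exponential of arbitrary vectors\<close>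

lemma tendsto_psi:
  assumes "(a \<longlongrightarrow> x) F" "norm x < r"
  shows "((\<lambda>k. psi (a k)) \<longlongrightarrow> psi x) F"
proof (rule isCont_tendsto_compose[OF _ assms(1)])
  show "isCont psi x"
    using continuous_psi assms(2) by (simp add: continuous_on_eq_continuous_at)
qed

lemma tendsto_phi:
  assumes "(a \<longlongrightarrow> g) F" "g \<in> V"
  shows "((\<lambda>k. phi (a k)) \<longlongrightarrow> phi g) F"
proof (rule isCont_tendsto_compose[OF _ assms(1)])
  show "isCont phi g"
    using continuous_phi assms(2) open_V by (simp add: continuous_on_eq_continuous_at)
qed

lemma eventually_V:
  assumes "(a \<longlongrightarrow> \<one>) F"
  shows "\<forall>\<^sub>F k in F. a k \<in> V"
  using assms open_V one_V by (rule topological_tendstoD)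

lemma tendsto_phi_one:
  assumes "(a \<longlongrightarrow> \<one>) F"
  shows "((\<lambda>k. phi (a k)) \<longlongrightarrow> 0) F"
  using tendsto_phi[OF assms one_V] by (simp add: phi_one)

lemma small_pow_tendsto:
  assumes a: "a \<longlonglongrightarrow> \<one>" and X: "(\<lambda>k. real (n k) *\<^sub>R phi (a k)) \<longlonglongrightarrow> X" "norm X < r0 / 2"
  shows "(\<lambda>k. a k [^] n k) \<longlonglongrightarrow> psi (local_exp X)"
proof -
  define x where "x = (\<lambda>k. phi (a k))"
  have x0: "x \<longlonglongrightarrow> 0" using tendsto_phi_one[OF a] by (simp add: x_def)
  have nx: "(\<lambda>k. real (n k) *\<^sub>R x k) \<longlonglongrightarrow> X" using X(1) by (simp add: x_def)
  have "\<forall>\<^sub>F k in sequentially. norm (real (n k) *\<^sub>R x k) < r0 / 2"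
    by (rule order_tendstoD(2)[OF tendsto_norm[OF nx] X(2)])
  then have ev1: "\<forall>\<^sub>F k in sequentially. real (n k) * norm (x k) < r0 / 2" by simp
  have ev2: "\<forall>\<^sub>F k in sequentially. psi (x k) = a k"
    using eventually_V[OF a] by eventually_elim (simp add: x_def psi_phi)
  have d1: "(\<lambda>k. phi (psi (x k) [^] n k) - local_exp (real (n k) *\<^sub>R x k)) \<longlonglongrightarrow> 0"
  proof (rule Lim_null_comparison)
    show "\<forall>\<^sub>F k in sequentially. norm (phi (psi (x k) [^] n k) - local_exp (real (n k) *\<^sub>R x k))
        \<le> 8 * C * norm (real (n k) *\<^sub>R x k) * norm (x k)"
      using ev1 by eventually_elim (use pow_local_exp in \<open>auto simp: less_imp_le\<close>)
    have "(\<lambda>k. 8 * C * norm (real (n k) *\<^sub>R x k) * norm (x k)) \<longlonglongrightarrow> 8 * C * norm X * norm (0::'v)"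
      by (intro tendsto_intros nx x0)
    then show "(\<lambda>k. 8 * C * norm (real (n k) *\<^sub>R x k) * norm (x k)) \<longlonglongrightarrow> 0" by simp
  qed
  have d2: "(\<lambda>k. local_exp (real (n k) *\<^sub>R x k) - local_exp X) \<longlonglongrightarrow> 0"
  proof (rule Lim_null_comparison)
    show "\<forall>\<^sub>F k in sequentially. norm (local_exp (real (n k) *\<^sub>R x k) - local_exp X)
        \<le> 4 * norm (real (n k) *\<^sub>R x k - X)"
      using ev1 by eventually_elim (rule local_exp_lipschitz, use X(2) in auto)
    have "(\<lambda>k. 4 * norm (real (n k) *\<^sub>R x k - X)) \<longlonglongrightarrow> 4 * norm (X - X)"
      by (intro tendsto_intros nx)
    then show "(\<lambda>k. 4 * norm (real (n k) *\<^sub>R x k - X)) \<longlonglongrightarrow> 0" by simp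
  qed
  have "(\<lambda>k. phi (psi (x k) [^] n k)) \<longlonglongrightarrow> local_exp X"
    using tendsto_add[OF tendsto_add[OF d1 d2] tendsto_const[of "local_exp X"]] by simp
  then have "(\<lambda>k. psi (phi (psi (x k) [^] n k))) \<longlonglongrightarrow> psi (local_exp X)"
    using local_exp_small X(2) by (intro tendsto_psi) auto
  moreover have "\<forall>\<^sub>F k in sequentially. psi (phi (psi (x k) [^] n k)) = a k [^] n k"
    using ev1 ev2
  proof eventually_elim
    case (elim k)
    then have "real (n k) * norm (x k) \<le> r0" using r0(1) by linarith
    from pow_phi(1)[OF this order_refl] elim show ?case by simp
  qed
  ultimately show ?thesis by (rule Lim_transform_eventually)
qed

definition expo :: "'v \<Rightarrow> 'g" where
  "expo X = lim (\<lambda>k. psi ((1 / real k) *\<^sub>R X) [^] k)"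

text \<open>Division with remainder by N reduces to small limits: the exponents n k div N fall under
  \<open>small_pow_tendsto\<close> with limit X / N, and fewer than N remaining factors tend to the
  identity.\<close>

lemma pow_tendsto:
  assumes a: "a \<longlonglongrightarrow> \<one>" and X: "(\<lambda>k. real (n k) *\<^sub>R phi (a k)) \<longlonglongrightarrow> X"
    and N: "N > 0" "norm ((1 / real N) *\<^sub>R X) < r0 / 2"
  shows "(\<lambda>k. a k [^] n k) \<longlonglongrightarrow> psi (local_exp ((1 / real N) *\<^sub>R X)) [^] N"
proof -
  define x where "x = (\<lambda>k. phi (a k))"
  have x0: "x \<longlonglongrightarrow> 0" using tendsto_phi_one[OF a] by (simp add: x_def)
  have rem: "(\<lambda>k. real (n k mod N) *\<^sub>R x k) \<longlonglongrightarrow> 0"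
  proof (rule Lim_null_comparison)
    show "\<forall>\<^sub>F k in sequentially. norm (real (n k mod N) *\<^sub>R x k) \<le> real N * norm (x k)"
      using N(1) by (intro always_eventually allI) (auto intro!: mult_right_mono)
    show "(\<lambda>k. real N * norm (x k)) \<longlonglongrightarrow> 0"
      using tendsto_mult_right_zero[OF tendsto_norm_zero[OF x0]] by blast
  qed
  have "(\<lambda>k. (1 / real N) *\<^sub>R (real (n k) *\<^sub>R x k - real (n k mod N) *\<^sub>R x k)) \<longlonglongrightarrow> (1 / real N) *\<^sub>R (X - 0)"
    using X by (intro tendsto_intros rem) (simp add: x_def)
  moreover have "(1 / real N) *\<^sub>R (real (n k) *\<^sub>R x k - real (n k mod N) *\<^sub>R x k) = real (n k div N) *\<^sub>R x k" for k
  proof -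
    have "real (n k) = real N * real (n k div N) + real (n k mod N)"
      by (metis mult_div_mod_eq of_nat_add of_nat_mult)
    then have "real (n k) *\<^sub>R x k - real (n k mod N) *\<^sub>R x k = (real N * real (n k div N)) *\<^sub>R x k"
      by (simp add: scaleR_left_distrib)
    then show ?thesis using N(1) by simp
  qed
  ultimately have quot: "(\<lambda>k. real (n k div N) *\<^sub>R phi (a k)) \<longlonglongrightarrow> (1 / real N) *\<^sub>R X"
    by (simp add: x_def)
  have "(\<lambda>k. (a k [^] (n k div N)) [^] N \<otimes> a k [^] (n k mod N)) \<longlonglongrightarrow>
      psi (local_exp ((1 / real N) *\<^sub>R X)) [^] N \<otimes> psi (local_exp 0)"
    using r0(1) rem
    by (intro tendsto_mult_group tendsto_pow_group small_pow_tendsto a quot N) (auto simp: x_def)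
  then show ?thesis
    by (simp add: nat_pow_pow nat_pow_mult local_exp_zero psi_zero)
qed

lemma exists_divisor:
  obtains N where "N > 0" "norm ((1 / real N) *\<^sub>R (X::'v)) < r0 / 2"
proof -
  obtain N where N: "norm X < real N * (r0 / 2)"
    using reals_Archimedean3[of "r0 / 2"] r0(1) by auto
  then have "N > 0" by (cases "N = 0") auto
  with N show ?thesis by (intro that[of N]) (auto simp: field_simps)
qed

lemma psi_seq:
  "(\<lambda>k. psi ((1 / real k) *\<^sub>R X)) \<longlonglongrightarrow> \<one>"
  "\<forall>\<^sub>F k in sequentially. phi (psi ((1 / real k) *\<^sub>R X)) = (1 / real k) *\<^sub>R X"
proof -
  have "(\<lambda>k. (1 / real k) *\<^sub>R X) \<longlonglongrightarrow> 0 *\<^sub>R X"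
    by (intro tendsto_intros lim_1_over_n)
  then have 0: "(\<lambda>k. (1 / real k) *\<^sub>R X) \<longlonglongrightarrow> 0" by simp
  from tendsto_psi[OF this] r_pos show "(\<lambda>k. psi ((1 / real k) *\<^sub>R X)) \<longlonglongrightarrow> \<one>"
    by (simp add: psi_zero)
  have "\<forall>\<^sub>F k in sequentially. norm ((1 / real k) *\<^sub>R X) < r"
    by (rule order_tendstoD(2)[OF tendsto_norm[OF 0]]) (use r_pos in simp)
  then show "\<forall>\<^sub>F k in sequentially. phi (psi ((1 / real k) *\<^sub>R X)) = (1 / real k) *\<^sub>R X"
    by eventually_elim (rule phi_psi)
qed

lemma psi_seq_scaled:
  assumes "(\<lambda>k. real (n k) / real k) \<longlonglongrightarrow> s"
  shows "(\<lambda>k. real (n k) *\<^sub>R phi (psi ((1 / real k) *\<^sub>R X))) \<longlonglongrightarrow> s *\<^sub>R X"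
proof -
  have "(\<lambda>k. (real (n k) / real k) *\<^sub>R X) \<longlonglongrightarrow> s *\<^sub>R X"
    by (intro tendsto_intros assms)
  moreover have "\<forall>\<^sub>F k in sequentially. (real (n k) / real k) *\<^sub>R X = real (n k) *\<^sub>R phi (psi ((1 / real k) *\<^sub>R X))"
    using psi_seq(2)[of X] by eventually_elim simp
  ultimately show ?thesis by (rule Lim_transform_eventually)
qed

lemma expo_eq:
  assumes "N > 0" "norm ((1 / real N) *\<^sub>R X) < r0 / 2"
  shows "expo X = psi (local_exp ((1 / real N) *\<^sub>R X)) [^] N"
proof -
  have "(\<lambda>k. real k / real k) \<longlonglongrightarrow> 1"
    by (rule tendsto_eventually) (auto intro: eventually_sequentiallyI[of 1])
  from pow_tendsto[OF psi_seq(1) psi_seq_scaled[OF this, of X, unfolded scaleR_one] assms]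
  show ?thesis unfolding expo_def by (rule limI)
qed

text \<open>The limit depends on the sequences only through X. Hence the additivity, inversion and
  naturality rules for \<open>expo\<close> follow by evaluating one sequence of powers in two
  ways.\<close>

theorem pow_tendsto_expo:
  assumes a: "a \<longlonglongrightarrow> \<one>" and X: "(\<lambda>k. real (n k) *\<^sub>R phi (a k)) \<longlonglongrightarrow> X"
  shows "(\<lambda>k. a k [^] n k) \<longlonglongrightarrow> expo X"
proof -
  obtain N where N: "N > 0" "norm ((1 / real N) *\<^sub>R X) < r0 / 2" by (rule exists_divisor)
  from pow_tendsto[OF a X N] show ?thesis by (simp add: expo_eq[OF N])
qed

lemma expo_small:
  assumes "norm X < r0 / 2"
  shows "expo X = psi (local_exp X)"
  using expo_eq[of 1 X] assms by simp

lemma phi_expo: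
  assumes "norm X < r0 / 2"
  shows "expo X \<in> V" "phi (expo X) = local_exp X"
  using assms local_exp_small[of X] by (auto simp: expo_small psi_V phi_psi)

lemma expo_zero: "expo 0 = \<one>"
  using expo_small[of 0] r0(1) by (simp add: local_exp_zero psi_zero)

end

section \<open>Tangent spaces of closed subgroups\<close>

text \<open>Rounding down costs at most one unit of c k. In this way natural exponents reach every
  real t \<ge> 0.\<close>

lemma floor_scale_tendsto:
  fixes c :: "'a \<Rightarrow> real"
  assumes c: "(c \<longlongrightarrow> 0) F" and pos: "\<forall>\<^sub>F k in F. c k > 0" and t: "t \<ge> 0"
  shows "((\<lambda>k. real (nat \<lfloor>t / c k\<rfloor>) * c k) \<longlongrightarrow> t) F"
proof (rule LIM_zero_cancel, rule Lim_null_comparison[OF _ c])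
  show "\<forall>\<^sub>F k in F. norm (real (nat \<lfloor>t / c k\<rfloor>) * c k - t) \<le> c k"
    using pos
  proof eventually_elim
    case (elim k)
    define q where "q = t / c k"
    have q: "q \<ge> 0" "q * c k = t" using elim t by (auto simp: q_def)
    have "q - 1 \<le> real (nat \<lfloor>q\<rfloor>)" "real (nat \<lfloor>q\<rfloor>) \<le> q" using q(1) by linarith+
    then have "(q - 1) * c k \<le> real (nat \<lfloor>q\<rfloor>) * c k" "real (nat \<lfloor>q\<rfloor>) * c k \<le> q * c k"
      using elim by (auto intro: mult_right_mono)
    then show ?case using q(2) elim unfolding q_def[symmetric] by (simp add: algebra_simps)
  qed
qed

lemma has_derivative_id_if_quadratic:
  fixes F :: "'v::real_normed_vector \<Rightarrow> 'v"
  assumes "d > 0" "\<And>X. norm X < d \<Longrightarrow> norm (F X - X) \<le> M * (norm X)\<^sup>2"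
  shows "(F has_derivative (\<lambda>x. x)) (at 0)"
proof -
  have F0: "F 0 = 0" using assms(2)[of 0] assms(1) by simp
  have "(\<lambda>h. norm (F (0 + h) - F 0 - h) / norm h) \<midarrow>0\<rightarrow> 0"
  proof (rule Lim_null_comparison)
    show "\<forall>\<^sub>F h in at 0. norm (norm (F (0 + h) - F 0 - h) / norm h) \<le> M * norm h"
      unfolding eventually_at
    proof (intro exI[of _ d] conjI ballI impI assms(1))
      fix h :: 'v assume h: "h \<noteq> 0 \<and> dist h 0 < d"
      then show "norm (norm (F (0 + h) - F 0 - h) / norm h) \<le> M * norm h"
        using assms(2)[of h] by (simp add: F0 divide_le_eq power2_eq_square mult_ac)
    qed
    have "((\<lambda>h::'v. M * norm h) \<longlongrightarrow> M * norm (0::'v)) (at 0)" by (intro tendsto_intros)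
    then show "((\<lambda>h::'v. M * norm h) \<longlongrightarrow> 0) (at 0)" by simp
  qed
  then show ?thesis by (simp add: has_derivative_at bounded_linear_ident)
qed

lemma difference_quotient_tendsto:
  fixes g :: "'v::real_normed_vector \<Rightarrow> 'w::real_normed_vector"
  assumes "(g has_derivative B) (at 0)" "g 0 = 0"
  shows "(\<lambda>k. real k *\<^sub>R g ((1 / real k) *\<^sub>R X)) \<longlonglongrightarrow> B X"
proof (cases "X = 0")
  case True
  then show ?thesis
    using linear_0[OF has_derivative_linear[OF assms(1)]] assms(2) by simp
next
  case False
  have lin: "linear B" by (rule has_derivative_linear[OF assms(1)])
  define h where "h k = (1 / real k) *\<^sub>R X" for k
  have "(\<lambda>k. (1 / real k) *\<^sub>R X) \<longlonglongrightarrow> 0 *\<^sub>R X" by (intro tendsto_intros lim_1_over_n)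
  then have h0: "h \<longlonglongrightarrow> 0" unfolding h_def by simp
  have ev: "\<forall>\<^sub>F k in sequentially. h k \<noteq> 0"
    by (rule eventually_sequentiallyI[of 1]) (use False in \<open>auto simp: h_def\<close>)
  have h: "filterlim h (at 0) sequentially"
    using h0 ev by (simp add: filterlim_at)
  have "(\<lambda>h. norm (g (0 + h) - g 0 - B h) / norm h) \<midarrow>0\<rightarrow> 0"
    using assms(1) by (simp add: has_derivative_at)
  from tendsto_mult_left[OF filterlim_compose[OF this h], of "norm X"]
  have "(\<lambda>k. norm X * (norm (g (h k) - B (h k)) / norm (h k))) \<longlonglongrightarrow> 0"
    using assms(2) by simp
  moreover have "\<forall>\<^sub>F k in sequentially. norm X * (norm (g (h k) - B (h k)) / norm (h k)) =
      norm (real k *\<^sub>R g (h k) - B X)"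
  proof (rule eventually_sequentiallyI[of 1])
    fix k :: nat assume k: "1 \<le> k"
    have "real k *\<^sub>R (g (h k) - B (h k)) = real k *\<^sub>R g (h k) - B X"
      using k by (simp add: h_def linear_scale[OF lin] scaleR_diff_right)
    then have "norm (real k *\<^sub>R g (h k) - B X) = real k * norm (g (h k) - B (h k))"
      by (metis norm_scaleR abs_of_nat)
    moreover have "norm (h k) = norm X / real k" using k by (simp add: h_def)
    ultimately show "norm X * (norm (g (h k) - B (h k)) / norm (h k)) = norm (real k *\<^sub>R g (h k) - B X)"
      using False k by simp
  qed
  ultimately have "(\<lambda>k. norm (real k *\<^sub>R g (h k) - B X)) \<longlonglongrightarrow> 0"
    by (rule Lim_transform_eventually)
  then show ?thesis unfolding h_def by (simp add: tendsto_norm_zero_iff LIM_zero_iff)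
qed

section \<open>Rules of computation for the exponential map\<close>

context lie_coordinates
begin

text \<open>For a = psi (X / k), the powers with exponents floor (s k) and floor (t k) multiply to
  the power with the summed exponent. The signs are restricted because exponents are natural
  numbers; negative multiples come from \<open>expo_minus\<close>.\<close>

lemma expo_add:
  assumes "s \<ge> 0" "t \<ge> 0"
  shows "expo ((s + t) *\<^sub>R X) = expo (s *\<^sub>R X) \<otimes> expo (t *\<^sub>R X)"
proof -
  have fl: "(\<lambda>k. real (nat \<lfloor>u * real k\<rfloor>) / real k) \<longlonglongrightarrow> u" if "u \<ge> 0" for u
    using floor_scale_tendsto[of "\<lambda>k. 1 / real k" sequentially u] that
    by (auto simp: lim_1_over_n intro!: eventually_sequentiallyI[of 1])
  define a where "a k = psi ((1 / real k) *\<^sub>R X)" for k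
  define n where "n u k = nat \<lfloor>u * real k\<rfloor>" for u :: real and k :: nat
  have lim: "(\<lambda>k. a k [^] m k) \<longlonglongrightarrow> expo (u *\<^sub>R X)" if "(\<lambda>k. real (m k) / real k) \<longlonglongrightarrow> u" for m u
    unfolding a_def by (rule pow_tendsto_expo[OF psi_seq(1) psi_seq_scaled[OF that]])
  have "(\<lambda>k. a k [^] n s k \<otimes> a k [^] n t k) \<longlonglongrightarrow> expo (s *\<^sub>R X) \<otimes> expo (t *\<^sub>R X)"
    unfolding n_def by (intro tendsto_mult_group lim fl assms)
  moreover have "(\<lambda>k. a k [^] (n s k + n t k)) \<longlonglongrightarrow> expo ((s + t) *\<^sub>R X)"
  proof (rule lim)
    have "(\<lambda>k. real (n s k) / real k + real (n t k) / real k) \<longlonglongrightarrow> s + t"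
      unfolding n_def by (intro tendsto_add fl assms)
    then show "(\<lambda>k. real (n s k + n t k) / real k) \<longlonglongrightarrow> s + t"
      by (simp add: add_divide_distrib)
  qed
  ultimately show ?thesis
    by (intro LIMSEQ_unique) (auto simp: nat_pow_mult)
qed

lemma expo_of_nat: "expo (real n *\<^sub>R X) = expo X [^] n"
proof (induction n)
  case (Suc n)
  have "expo ((real n + 1) *\<^sub>R X) = expo (real n *\<^sub>R X) \<otimes> expo (1 *\<^sub>R X)"
    by (rule expo_add) auto
  then show ?case using Suc by (simp add: add.commute)
qed (simp add: expo_zero)

text \<open>The deviation from additivity is bilinear: one factor, scaled by c k, stays bounded
  while the other tends to 0.\<close>

lemma log_mult_tendsto:
  assumes a: "a \<longlonglongrightarrow> \<one>" and b: "b \<longlonglongrightarrow> \<one>"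
    and X: "(\<lambda>k. c k *\<^sub>R phi (a k)) \<longlonglongrightarrow> X" and Y: "(\<lambda>k. c k *\<^sub>R phi (b k)) \<longlonglongrightarrow> Y"
  shows "(\<lambda>k. c k *\<^sub>R phi (a k \<otimes> b k)) \<longlonglongrightarrow> X + Y"
proof -
  define d where "d k = phi (a k \<otimes> b k) - phi (a k) - phi (b k)" for k
  note a0 = tendsto_phi_one[OF a] and b0 = tendsto_phi_one[OF b]
  have "(\<lambda>k. c k *\<^sub>R d k) \<longlonglongrightarrow> 0"
  proof (rule Lim_null_comparison)
    have "\<forall>\<^sub>F k in sequentially. norm (phi (a k)) < r" "\<forall>\<^sub>F k in sequentially. norm (phi (b k)) < r"
      using order_tendstoD(2)[OF tendsto_norm[OF a0]] order_tendstoD(2)[OF tendsto_norm[OF b0]] r_pos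
      by auto
    then show "\<forall>\<^sub>F k in sequentially. norm (c k *\<^sub>R d k) \<le> C * norm (c k *\<^sub>R phi (a k)) * norm (phi (b k))"
      using eventually_V[OF a] eventually_V[OF b]
    proof eventually_elim
      case (elim k)
      have "norm (d k) \<le> C * norm (phi (a k)) * norm (phi (b k))"
        using mult_approx[OF elim(1,2)] elim(3,4) by (simp add: psi_phi d_def)
      from mult_left_mono[OF this, of "\<bar>c k\<bar>"] show ?case by (simp add: mult_ac)
    qed
    have "(\<lambda>k. C * norm (c k *\<^sub>R phi (a k)) * norm (phi (b k))) \<longlonglongrightarrow> C * norm X * norm (0::'v)"
      by (intro tendsto_intros X b0)
    then show "(\<lambda>k. C * norm (c k *\<^sub>R phi (a k)) * norm (phi (b k))) \<longlonglongrightarrow> 0" by simp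
  qed
  from tendsto_add[OF this tendsto_add[OF X Y]] show ?thesis
    by (simp add: d_def scaleR_diff_right)
qed

text \<open>The product of a k and its inverse has coordinate 0, so \<open>mult_approx\<close>
  bounds the sum of their coordinates by a product of two small terms.\<close>

lemma log_inv_tendsto:
  assumes a: "a \<longlonglongrightarrow> \<one>" and X: "(\<lambda>k. c k *\<^sub>R phi (a k)) \<longlonglongrightarrow> X"
  shows "(\<lambda>k. c k *\<^sub>R phi (inv (a k))) \<longlonglongrightarrow> - X"
proof -
  have b: "(\<lambda>k. inv (a k)) \<longlonglongrightarrow> \<one>" using tendsto_inv_group[OF a] by simp
  define d where "d k = phi (a k) + phi (inv (a k))" for k
  note a0 = tendsto_phi_one[OF a] and b0 = tendsto_phi_one[OF b]
  have "(\<lambda>k. c k *\<^sub>R d k) \<longlonglongrightarrow> 0"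
  proof (rule Lim_null_comparison)
    have "\<forall>\<^sub>F k in sequentially. norm (phi (a k)) < r" "\<forall>\<^sub>F k in sequentially. norm (phi (inv (a k))) < r"
      using order_tendstoD(2)[OF tendsto_norm[OF a0]] order_tendstoD(2)[OF tendsto_norm[OF b0]] r_pos
      by auto
    then show "\<forall>\<^sub>F k in sequentially. norm (c k *\<^sub>R d k) \<le> C * norm (c k *\<^sub>R phi (a k)) * norm (phi (inv (a k)))"
      using eventually_V[OF a] eventually_V[OF b]
    proof eventually_elim
      case (elim k)
      have "- phi (a k) - phi (inv (a k)) = - d k" by (simp add: d_def)
      then have "norm (d k) \<le> C * norm (phi (a k)) * norm (phi (inv (a k)))"
        using mult_approx[OF elim(1,2)] elim(3,4) by (simp add: psi_phi phi_one)
      from mult_left_mono[OF this, of "\<bar>c k\<bar>"] show ?case by (simp add: mult_ac)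
    qed
    have "(\<lambda>k. C * norm (c k *\<^sub>R phi (a k)) * norm (phi (inv (a k)))) \<longlonglongrightarrow> C * norm X * norm (0::'v)"
      by (intro tendsto_intros X b0)
    then show "(\<lambda>k. C * norm (c k *\<^sub>R phi (a k)) * norm (phi (inv (a k)))) \<longlonglongrightarrow> 0" by simp
  qed
  from tendsto_diff[OF this X] show ?thesis by (simp add: d_def scaleR_add_right)
qed

lemma psi_seq_limit: "(\<lambda>k. psi ((1 / real k) *\<^sub>R X) [^] k) \<longlonglongrightarrow> expo X"
  "(\<lambda>k. real k *\<^sub>R phi (psi ((1 / real k) *\<^sub>R X))) \<longlonglongrightarrow> X"
proof -
  have "(\<lambda>k. real k / real k) \<longlonglongrightarrow> 1"
    by (rule tendsto_eventually) (auto intro: eventually_sequentiallyI[of 1])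
  from psi_seq_scaled[OF this, of X]
  show *: "(\<lambda>k. real k *\<^sub>R phi (psi ((1 / real k) *\<^sub>R X))) \<longlonglongrightarrow> X" by simp
  show "(\<lambda>k. psi ((1 / real k) *\<^sub>R X) [^] k) \<longlonglongrightarrow> expo X"
    by (rule pow_tendsto_expo[OF psi_seq(1) *])
qed

lemma expo_minus: "expo (- X) = inv (expo X)"
proof -
  define a where "a k = psi ((1 / real k) *\<^sub>R X)" for k
  have a: "a \<longlonglongrightarrow> \<one>" unfolding a_def by (rule psi_seq(1))
  have b: "(\<lambda>k. inv (a k)) \<longlonglongrightarrow> \<one>" using tendsto_inv_group[OF a] by simp
  have "(\<lambda>k. real k *\<^sub>R phi (inv (a k))) \<longlonglongrightarrow> - X"
    by (rule log_inv_tendsto[OF a]) (unfold a_def, rule psi_seq_limit)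
  from pow_tendsto_expo[OF b this] have "(\<lambda>k. inv (a k) [^] k) \<longlonglongrightarrow> expo (- X)" .
  moreover have "(\<lambda>k. inv (a k [^] k)) \<longlonglongrightarrow> inv (expo X)"
    unfolding a_def by (intro tendsto_inv_group psi_seq_limit)
  ultimately show ?thesis
    by (intro LIMSEQ_unique) (auto simp: nat_pow_inv)
qed

lemma local_exp_norm:
  assumes "norm X < r0 / 2"
  shows "norm (local_exp X) \<le> 4 * norm X"
  using local_exp_lipschitz[of X 0] assms r0(1) by (simp add: local_exp_zero)

lemma tendsto_local_exp:
  assumes Y: "(Y \<longlongrightarrow> X) F" and X: "norm X < r0 / 2"
  shows "((\<lambda>k. local_exp (Y k)) \<longlongrightarrow> local_exp X) F"
proof (rule LIM_zero_cancel, rule Lim_null_comparison)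
  have "\<forall>\<^sub>F k in F. norm (Y k) < r0 / 2"
    by (rule order_tendstoD(2)[OF tendsto_norm[OF Y] X])
  then show "\<forall>\<^sub>F k in F. norm (local_exp (Y k) - local_exp X) \<le> 4 * norm (Y k - X)"
    by eventually_elim (rule local_exp_lipschitz, use X in auto)
  have "((\<lambda>k. 4 * norm (Y k - X)) \<longlongrightarrow> 4 * norm (X - X)) F" by (intro tendsto_intros Y)
  then show "((\<lambda>k. 4 * norm (Y k - X)) \<longlongrightarrow> 0) F" by simp
qed

lemma tendsto_expo:
  assumes Y: "(Y \<longlongrightarrow> X) F"
  shows "((\<lambda>k. expo (Y k)) \<longlongrightarrow> expo X) F"
proof -
  obtain N where N: "N > 0" "norm ((1 / real N) *\<^sub>R X) < r0 / 2" by (rule exists_divisor)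
  have Z: "((\<lambda>k. (1 / real N) *\<^sub>R Y k) \<longlongrightarrow> (1 / real N) *\<^sub>R X) F" by (intro tendsto_intros Y)
  have "((\<lambda>k. psi (local_exp ((1 / real N) *\<^sub>R Y k)) [^] N) \<longlongrightarrow> psi (local_exp ((1 / real N) *\<^sub>R X)) [^] N) F"
    using N by (intro tendsto_pow_group tendsto_psi tendsto_local_exp Z local_exp_small) auto
  moreover have "\<forall>\<^sub>F k in F. psi (local_exp ((1 / real N) *\<^sub>R Y k)) [^] N = expo (Y k)"
    using order_tendstoD(2)[OF tendsto_norm[OF Z] N(2)] by eventually_elim (simp add: expo_eq[OF N(1)])
  ultimately show ?thesis
    unfolding expo_eq[OF N] by (rule Lim_transform_eventually)
qed

lemma continuous_on_expo:
  assumes "continuous_on S Y"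
  shows "continuous_on S (\<lambda>x. expo (Y x))"
  using assms unfolding continuous_on_def by (blast intro: tendsto_expo)

lemma log_expo_tendsto:
  assumes Y: "Y \<longlonglongrightarrow> 0" and X: "(\<lambda>k. c k *\<^sub>R Y k) \<longlonglongrightarrow> X"
  shows "(\<lambda>k. expo (Y k)) \<longlonglongrightarrow> \<one>" "(\<lambda>k. c k *\<^sub>R phi (expo (Y k))) \<longlonglongrightarrow> X"
proof -
  show "(\<lambda>k. expo (Y k)) \<longlonglongrightarrow> \<one>" using tendsto_expo[OF Y] by (simp add: expo_zero)
  have "(\<lambda>k. c k *\<^sub>R (phi (expo (Y k)) - Y k)) \<longlonglongrightarrow> 0"
  proof (rule Lim_null_comparison)
    have "\<forall>\<^sub>F k in sequentially. norm (Y k) < r0 / 2"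
      by (rule order_tendstoD(2)[OF tendsto_norm[OF Y]]) (use r0(1) in simp)
    then show "\<forall>\<^sub>F k in sequentially. norm (c k *\<^sub>R (phi (expo (Y k)) - Y k)) \<le> 2 * C * norm (c k *\<^sub>R Y k) * norm (Y k)"
    proof eventually_elim
      case (elim k)
      have "norm (phi (expo (Y k)) - Y k) \<le> 2 * C * (norm (Y k))\<^sup>2"
        using local_exp_approx[of "Y k"] elim by (simp add: phi_expo)
      from mult_left_mono[OF this, of "\<bar>c k\<bar>"] show ?case by (simp add: power2_eq_square mult_ac)
    qed
    have "(\<lambda>k. 2 * C * norm (c k *\<^sub>R Y k) * norm (Y k)) \<longlonglongrightarrow> 2 * C * norm X * norm (0::'v)"
      by (intro tendsto_intros X Y)
    then show "(\<lambda>k. 2 * C * norm (c k *\<^sub>R Y k) * norm (Y k)) \<longlonglongrightarrow> 0" by simp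
  qed
  from tendsto_add[OF this X] show "(\<lambda>k. c k *\<^sub>R phi (expo (Y k))) \<longlonglongrightarrow> X"
    by (simp add: scaleR_diff_right)
qed

text \<open>The Lie product formula: k times the coordinates of the base of the k-th power tends to
  X + Y.\<close>

lemma trotter:
  "(\<lambda>k. (expo ((1 / real k) *\<^sub>R X) \<otimes> expo ((1 / real k) *\<^sub>R Y)) [^] k) \<longlonglongrightarrow> expo (X + Y)"
proof -
  have 0: "(\<lambda>k. (1 / real k) *\<^sub>R Z) \<longlonglongrightarrow> 0" for Z :: 'v
  proof -
    have "(\<lambda>k. (1 / real k) *\<^sub>R Z) \<longlonglongrightarrow> 0 *\<^sub>R Z" by (intro tendsto_intros lim_1_over_n)
    then show ?thesis by simp
  qed
  have 1: "(\<lambda>k. real k *\<^sub>R (1 / real k) *\<^sub>R Z) \<longlonglongrightarrow> Z" for Z :: 'v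
    by (rule tendsto_eventually, rule eventually_sequentiallyI[of 1]) simp
  note e = log_expo_tendsto[OF 0 1]
  show ?thesis
    using tendsto_mult_group[OF e(1) e(1), of X Y]
    by (intro pow_tendsto_expo log_mult_tendsto e) auto
qed

text \<open>A homomorphism maps the k-th power of psi (X / k) to the k-th power of h (psi (X / k)),
  whose coordinates multiplied by k tend to B X as a difference quotient.\<close>

lemma hom_expo:
  assumes hom: "\<And>x y. h (x \<otimes> y) = h x \<otimes> h y" and cont: "continuous_on UNIV h"
    and der: "((\<lambda>x. phi (h (psi x))) has_derivative B) (at 0)"
  shows "h (expo X) = expo (B X)"
proof -
  have one: "h \<one> = \<one>"
    using hom[of \<one> \<one>] by (metis r_cancel_one carrier_UNIV UNIV_I r_one one_closed)
  have pow: "h (x [^] n) = h x [^] n" for x and n :: nat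
    by (induction n) (auto simp: one hom)
  have lim: "(\<lambda>k. h (a k)) \<longlonglongrightarrow> h x" if "a \<longlonglongrightarrow> x" for a x
    using continuous_on_tendsto_compose[OF cont that] by simp
  have "(\<lambda>k. h (psi ((1 / real k) *\<^sub>R X))) \<longlonglongrightarrow> \<one>"
    using lim[OF psi_seq(1)] by (simp add: one)
  moreover have "(\<lambda>k. real k *\<^sub>R phi (h (psi ((1 / real k) *\<^sub>R X)))) \<longlonglongrightarrow> B X"
    by (rule difference_quotient_tendsto[OF der]) (simp add: psi_zero one phi_one)
  ultimately have "(\<lambda>k. h (psi ((1 / real k) *\<^sub>R X)) [^] k) \<longlonglongrightarrow> expo (B X)"
    by (rule pow_tendsto_expo)
  moreover have "(\<lambda>k. h (psi ((1 / real k) *\<^sub>R X) [^] k)) \<longlonglongrightarrow> h (expo X)"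
    by (intro lim psi_seq_limit)
  ultimately show ?thesis by (intro LIMSEQ_unique) (auto simp: pow)
qed

section \<open>Tangent spaces and Cartan's closed subgroup theorem\<close>

lemma subgroup_pow:
  assumes "subgroup E G" "x \<in> E"
  shows "x [^] (n::nat) \<in> E"
  using assms by (induction n) (auto intro: subgroup.one_closed subgroup.m_closed)

text \<open>For a closed subgroup this is its Lie algebra, described by one-parameter subgroups
  rather than by a submanifold structure.\<close>

definition tangent :: "'g set \<Rightarrow> 'v set" where
  "tangent E = {X. \<forall>t. expo (t *\<^sub>R X) \<in> E}"

lemma expo_tangent: "X \<in> tangent E \<Longrightarrow> expo X \<in> E"
  unfolding tangent_def using scaleR_one by (metis (mono_tags) mem_Collect_eq)

lemma tangentI_nonneg:
  assumes E: "subgroup E G" and X: "\<And>t. t \<ge> 0 \<Longrightarrow> expo (t *\<^sub>R X) \<in> E"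
  shows "X \<in> tangent E"
proof -
  have "expo (t *\<^sub>R X) \<in> E" if "t < 0" for t
  proof -
    have "inv (expo ((- t) *\<^sub>R X)) \<in> E" using that by (intro subgroup.m_inv_closed[OF E] X) auto
    then show ?thesis by (simp add: expo_minus[symmetric])
  qed
  then show ?thesis using X unfolding tangent_def by (auto simp: not_le[symmetric])
qed

text \<open>Sums are the point: \<open>trotter\<close> exhibits exp (t (X + Y)) as a limit of
  elements of E, and E is closed.\<close>

lemma subspace_tangent:
  assumes E: "subgroup E G" and cl: "closed E"
  shows "subspace (tangent E)"
proof (rule subspaceI)
  show "0 \<in> tangent E"
    using subgroup.one_closed[OF E] by (simp add: tangent_def expo_zero)
  show "c *\<^sub>R X \<in> tangent E" if "X \<in> tangent E" for c X
    using that by (simp add: tangent_def)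
  show "X + Y \<in> tangent E" if "X \<in> tangent E" "Y \<in> tangent E" for X Y
    unfolding tangent_def
  proof (intro CollectI allI)
    fix t
    have "expo (t *\<^sub>R X + t *\<^sub>R Y) \<in> E"
    proof (rule Lim_in_closed_set[OF cl _ _ trotter])
      show "\<forall>\<^sub>F k in sequentially.
          (expo ((1 / real k) *\<^sub>R t *\<^sub>R X) \<otimes> expo ((1 / real k) *\<^sub>R t *\<^sub>R Y)) [^] k \<in> E"
        using that E
        by (intro always_eventually allI subgroup_pow subgroup.m_closed) (auto simp: tangent_def)
    qed simp
    then show "expo (t *\<^sub>R (X + Y)) \<in> E" by (simp add: scaleR_add_right)
  qed
qed

text \<open>Inverse function theorem for \<open>X \<mapsto> exp (X - p X) exp (p X)\<close>, whose derivative at 0 is the identity.\<close>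
lemma product_coordinates:
  assumes p: "linear p" and e: "e > 0"
  obtains d where "d > 0"
    "\<And>g. g \<in> V \<Longrightarrow> norm (phi g) < d \<Longrightarrow> \<exists>X. norm (X - p X) < e \<and> g = expo (X - p X) \<otimes> expo (p X)"
proof -
  obtain K where K: "K > 0" "\<And>X. norm (p X) \<le> K * norm X"
    using linear_bounded_pos[OF p] by (metis mult.commute)
  have pos: "min e (r0 / 2) > 0" using e r0(1) by simp
  \<comment> \<open>Both X - p X and p X have norm at most (1 + K) * norm X, so this choice keeps
    them below e and inside the domain where \<open>local_exp\<close> is controlled.\<close>
  define d where "d = min e (r0 / 2) / (2 * (1 + K))"
  have d: "d > 0" using e r0(1) K by (simp add: d_def)
  have small: "norm (X - p X) < min e (r0 / 2)" "norm (p X) < min e (r0 / 2)"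
    "norm (X - p X) \<le> (1 + K) * norm X" "norm (p X) \<le> (1 + K) * norm X" if "norm X < d" for X
  proof -
    have "(1 + K) * norm X \<le> (1 + K) * d" using that K by (intro mult_left_mono) auto
    also have "(1 + K) * d = min e (r0 / 2) / 2"
      using K unfolding d_def by (simp add: field_simps)
    also have "\<dots> < min e (r0 / 2)" using pos by linarith
    finally have *: "(1 + K) * norm X < min e (r0 / 2)" .
    show A: "norm (X - p X) \<le> (1 + K) * norm X"
      using norm_triangle_ineq4[of X "p X"] K(2)[of X] by (simp add: algebra_simps)
    show B: "norm (p X) \<le> (1 + K) * norm X"
      using K(2)[of X] by (simp add: algebra_simps add_increasing)
    show "norm (X - p X) < min e (r0 / 2)" "norm (p X) < min e (r0 / 2)"
      using A B * by linarith+
  qed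
  define Q where "Q X = expo (X - p X) \<otimes> expo (p X)" for X
  define F where "F X = phi (Q X)" for X
  have Qpsi: "Q X = psi (local_exp (X - p X)) \<otimes> psi (local_exp (p X))" if "norm X < d" for X
    using small[OF that] by (simp add: Q_def expo_small)
  have QV: "Q X \<in> V" if "norm X < d" for X
    unfolding Qpsi[OF that] using small[OF that] by (intro mult_V local_exp_small) auto
  have contF: "continuous_on (ball 0 d) F"
  proof -
    have cp: "continuous_on (ball 0 d) p" by (rule linear_continuous_on) (simp add: p linear_linear)
    have "continuous_on (ball 0 d) Q"
      unfolding Q_def
      by (intro continuous_on_mult_group continuous_on_expo continuous_intros cp)
    from continuous_on_compose2[OF continuous_phi this] show ?thesis
      unfolding F_def using QV by force
  qed
  \<comment> \<open>The constant is 16 + 2 + 2: the product error for factors of norm at most 4 * m,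
    and the quadratic error of each exponential.\<close>
  have quad: "norm (F X - X) \<le> 20 * C * (1 + K)\<^sup>2 * (norm X)\<^sup>2" if X: "norm X < d" for X
  proof -
    define y where "y = local_exp (X - p X)"
    define z where "z = local_exp (p X)"
    define m where "m = (1 + K) * norm X"
    have m0: "m \<ge> 0" using K by (simp add: m_def)
    note s = small[OF X, folded m_def]
    have y: "norm y \<le> 4 * m" "norm (y - (X - p X)) \<le> 2 * C * m\<^sup>2" "norm y < r"
    proof -
      show "norm y \<le> 4 * m" using local_exp_norm[of "X - p X"] s by (simp add: y_def)
      have "norm (y - (X - p X)) \<le> 2 * C * (norm (X - p X))\<^sup>2"
        using local_exp_approx[of "X - p X"] s by (simp add: y_def)
      also have "\<dots> \<le> 2 * C * m\<^sup>2" using s C_pos by (intro mult_left_mono power_mono) auto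
      finally show "norm (y - (X - p X)) \<le> 2 * C * m\<^sup>2" .
      show "norm y < r" unfolding y_def using s by (intro local_exp_small) auto
    qed
    have z: "norm z \<le> 4 * m" "norm (z - p X) \<le> 2 * C * m\<^sup>2" "norm z < r"
    proof -
      show "norm z \<le> 4 * m" using local_exp_norm[of "p X"] s by (simp add: z_def)
      have "norm (z - p X) \<le> 2 * C * (norm (p X))\<^sup>2"
        using local_exp_approx[of "p X"] s by (simp add: z_def)
      also have "\<dots> \<le> 2 * C * m\<^sup>2" using s C_pos by (intro mult_left_mono power_mono) auto
      finally show "norm (z - p X) \<le> 2 * C * m\<^sup>2" .
      show "norm z < r" unfolding z_def using s by (intro local_exp_small) auto
    qed
    have "norm (F X - y - z) \<le> C * norm y * norm z"
      unfolding F_def Qpsi[OF X] y_def[symmetric] z_def[symmetric] using y z by (intro mult_approx)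
    also have "\<dots> \<le> C * (4 * m) * (4 * m)"
      using y z C_pos m0 by (intro mult_mono) auto
    finally have "norm (F X - y - z) \<le> 16 * C * m\<^sup>2" by (simp add: power2_eq_square)
    moreover have "F X - X = (F X - y - z) + (y - (X - p X)) + (z - p X)" by simp
    ultimately have "norm (F X - X) \<le> 16 * C * m\<^sup>2 + 2 * C * m\<^sup>2 + 2 * C * m\<^sup>2"
      using y(2) z(2) by (smt (verit) norm_triangle_ineq)
    then show ?thesis by (simp add: m_def power_mult_distrib mult_ac)
  qed
  have der: "(F has_derivative (\<lambda>x. x)) (at 0)"
    by (rule has_derivative_id_if_quadratic[OF d quad])
  have F0: "F 0 = 0" using quad[of 0] d by simp
  \<comment> \<open>The derivative of F is known at 0 alone, so openness at 0 comes from the open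
    mapping theorem for continuous maps differentiable at one point.\<close>
  have "F 0 \<in> interior (F ` ball 0 d)"
    by (rule sussmann_open_mapping[OF open_ball contF _ der bounded_linear_ident])
      (use d in auto)
  then obtain d' where d': "d' > 0" "ball 0 d' \<subseteq> F ` ball 0 d"
    unfolding F0 mem_interior by (elim exE conjE)
  show ?thesis
  proof (rule that[OF d'(1)])
    fix g assume g: "g \<in> V" "norm (phi g) < d'"
    then obtain X where X: "norm X < d" "phi g = F X"
      using d'(2) by (auto simp: subset_iff image_iff)
    have "g = psi (F X)" using psi_phi[OF g(1)] X(2) by simp
    also have "\<dots> = Q X" unfolding F_def by (rule psi_phi[OF QV[OF X(1)]])
    finally have "g = Q X" .
    then show "\<exists>X. norm (X - p X) < e \<and> g = expo (X - p X) \<otimes> expo (p X)"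
      using small(1)[OF X(1)] by (auto simp: Q_def)
  qed
qed

text \<open>The powers of exp (Y k) with exponent floor (t / norm (Y k)) lie in E and converge to
  exp (t y).\<close>

lemma tangent_direction:
  assumes E: "subgroup E G" and cl: "closed E"
    and Y: "Y \<longlonglongrightarrow> 0" "\<And>k. Y k \<noteq> 0" "\<And>k. expo (Y k) \<in> E"
    and y: "(\<lambda>k. (1 / norm (Y k)) *\<^sub>R Y k) \<longlonglongrightarrow> y"
  shows "y \<in> tangent E"
proof (rule tangentI_nonneg[OF E])
  fix t :: real assume t: "t \<ge> 0"
  define n where "n k = nat \<lfloor>t / norm (Y k)\<rfloor>" for k
  have "(\<lambda>k. real (n k) * norm (Y k)) \<longlonglongrightarrow> t"
    unfolding n_def using Y(1,2) t by (intro floor_scale_tendsto) (auto intro: tendsto_norm_zero)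
  from tendsto_scaleR[OF this y] have "(\<lambda>k. real (n k) *\<^sub>R Y k) \<longlonglongrightarrow> t *\<^sub>R y"
    using Y(2) by simp
  note lim = log_expo_tendsto[OF Y(1) this]
  show "expo (t *\<^sub>R y) \<in> E"
    by (rule Lim_in_closed_set[OF cl _ _ pow_tendsto_expo[OF lim]])
      (auto intro!: always_eventually subgroup_pow E Y(3))
qed

text \<open>If this failed, splitting off the component along \<open>tangent E\<close> would leave
  nonzero vectors Y k in the kernel of a projection p, tending to 0, with exponentials in E. A limit
  of their directions is tangent to E and lies in the kernel of p, yet has norm 1.\<close>

lemma closed_subgroup_exponential:
  assumes E: "subgroup E G" and cl: "closed E"
  shows "\<exists>d>0. \<forall>g\<in>E \<inter> V. norm (phi g) < d \<longrightarrow> g \<in> expo ` tangent E"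
proof (rule ccontr)
  assume "\<not> ?thesis"
  then have no: "\<exists>g. g \<in> E \<and> g \<in> V \<and> norm (phi g) < d \<and> g \<notin> expo ` tangent E" if "d > 0" for d
    using that by blast
  have sub: "subspace (tangent E)" by (rule subspace_tangent[OF E cl])
  \<comment> \<open>A left inverse of the identity map on a subspace, with range inside it, is a
    projection onto it.\<close>
  obtain p where p: "linear p" "range p \<subseteq> tangent E" "\<And>v. v \<in> tangent E \<Longrightarrow> p v = v"
    using linear_exists_left_inverse_on[OF linear_id sub] by auto
  have "\<exists>Y. norm Y < 1 / real (Suc k) \<and> Y \<noteq> 0 \<and> p Y = 0 \<and> expo Y \<in> E" for k
  proof -
    obtain d where d: "d > 0"
      "\<And>g. g \<in> V \<Longrightarrow> norm (phi g) < d \<Longrightarrow>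
        \<exists>X. norm (X - p X) < 1 / real (Suc k) \<and> g = expo (X - p X) \<otimes> expo (p X)"
      by (rule product_coordinates[OF p(1), of "1 / real (Suc k)"]) auto
    obtain g where g: "g \<in> E" "g \<in> V" "norm (phi g) < d" "g \<notin> expo ` tangent E"
      using no[OF d(1)] by blast
    obtain X where X: "norm (X - p X) < 1 / real (Suc k)" "g = expo (X - p X) \<otimes> expo (p X)"
      using d(2)[OF g(2,3)] by blast
    have pX: "p X \<in> tangent E" using p(2) by auto
    have "expo (X - p X) = g \<otimes> inv (expo (p X))"
      by (simp add: X(2) m_assoc)
    also have "\<dots> \<in> E"
      using expo_tangent[OF pX] g(1) by (intro subgroup.m_closed[OF E] subgroup.m_inv_closed[OF E])
    finally have "expo (X - p X) \<in> E" .
    moreover have "X - p X \<noteq> 0"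
    proof
      assume "X - p X = 0"
      then have "g = expo (p X)" using X(2) by (simp add: expo_zero)
      then show False using g(4) pX by blast
    qed
    moreover have "p (X - p X) = 0" using p(3)[OF pX] by (simp add: linear_diff[OF p(1)])
    ultimately show ?thesis using X(1) by blast
  qed
  then obtain Y where Y: "\<And>k. norm (Y k) < 1 / real (Suc k)" "\<And>k. Y k \<noteq> 0"
    "\<And>k. p (Y k) = 0" "\<And>k. expo (Y k) \<in> E"
    by metis
  have Y0: "Y \<longlonglongrightarrow> 0"
  proof (rule Lim_null_comparison)
    show "\<forall>\<^sub>F k in sequentially. norm (Y k) \<le> 1 / real (Suc k)"
      using Y(1) by (intro always_eventually allI less_imp_le)
    show "(\<lambda>k. 1 / real (Suc k)) \<longlonglongrightarrow> 0"
      using LIMSEQ_Suc[OF lim_1_over_n] .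
  qed
  define y where "y k = (1 / norm (Y k)) *\<^sub>R Y k" for k
  have "y k \<in> sphere 0 1" for k using Y(2) by (simp add: y_def)
  then obtain l s where l: "l \<in> sphere 0 1" "strict_mono (s :: nat \<Rightarrow> nat)" "(y \<circ> s) \<longlonglongrightarrow> l"
    using compact_sphere[of "0::'v" 1] unfolding compact_def by meson
  have "l \<in> tangent E"
  proof (rule tangent_direction[OF E cl, of "\<lambda>k. Y (s k)"])
    show "(\<lambda>k. Y (s k)) \<longlonglongrightarrow> 0"
      using LIMSEQ_subseq_LIMSEQ[OF Y0 l(2)] by (simp add: o_def)
    show "(\<lambda>k. (1 / norm (Y (s k))) *\<^sub>R Y (s k)) \<longlonglongrightarrow> l"
      using l(3) by (simp add: o_def y_def)
  qed (use Y in auto)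
  then have "p l = l" by (rule p(3))
  moreover have "(\<lambda>k. p (y (s k))) \<longlonglongrightarrow> p l"
    using l(3) linear_continuous_at[of p l] p(1)
    by (intro isCont_tendsto_compose[of l p]) (auto simp: o_def linear_linear)
  moreover have "p (y k) = 0" for k by (simp add: y_def linear_scale[OF p(1)] Y(3))
  ultimately have "l = 0" using LIMSEQ_unique[OF tendsto_const, of 0 l] by simp
  then show False using l(1) by simp
qed

text \<open>E \<inter> H is closed in E. It is also open in E, because near the identity E consists
  of exponentials of its tangent vectors and translation carries this to every point of E \<inter>
  H.\<close>

lemma subset_if_tangent_subset:
  assumes E: "subgroup E G" "closed E" "connected E" and H: "subgroup H G" "closed H"
    and tan: "tangent E \<subseteq> tangent H"
  shows "E \<subseteq> H"
proof -
  obtain d where d: "d > 0" "\<And>g. g \<in> E \<Longrightarrow> g \<in> V \<Longrightarrow> norm (phi g) < d \<Longrightarrow> g \<in> expo ` tangent E"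
    using closed_subgroup_exponential[OF E(1,2)] by blast
  define N where "N = V \<inter> phi -` ball 0 d"
  have N: "open N" unfolding N_def by (rule continuous_open_preimage[OF continuous_phi open_V open_ball])
  have "openin (top_of_set E) (E \<inter> H)"
  proof (subst openin_subopen, intro ballI)
    fix g assume g: "g \<in> E \<inter> H"
    define W where "W = (\<lambda>x. inv g \<otimes> x) -` N"
    have "continuous_on UNIV (\<lambda>x. inv g \<otimes> x)"
      by (intro continuous_on_mult_group continuous_intros)
    then have "open W" unfolding W_def using N by (simp add: open_vimage)
    then have "openin (top_of_set E) (E \<inter> W)" by (rule openin_open_Int)
    moreover have "g \<in> E \<inter> W" using g d(1) by (simp add: W_def N_def one_V phi_one)
    moreover have "E \<inter> W \<subseteq> E \<inter> H"
    proof
      fix x assume x: "x \<in> E \<inter> W"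
      have "inv g \<otimes> x \<in> E" using x g by (intro subgroup.m_closed[OF E(1)] subgroup.m_inv_closed[OF E(1)]) auto
      then have "inv g \<otimes> x \<in> expo ` tangent E"
        using x by (intro d(2)) (auto simp: W_def N_def)
      then have "inv g \<otimes> x \<in> H" by (auto intro: expo_tangent[OF subsetD[OF tan]])
      then have "g \<otimes> (inv g \<otimes> x) \<in> H"
        using g by (intro subgroup.m_closed[OF H(1), of g "inv g \<otimes> x"]) auto
      then show "x \<in> E \<inter> H" using x by (simp add: m_assoc[symmetric])
    qed
    ultimately show "\<exists>T. openin (top_of_set E) T \<and> g \<in> T \<and> T \<subseteq> E \<inter> H" by blast
  qed
  moreover have "closedin (top_of_set E) (E \<inter> H)" using H(2) by (rule closedin_closed_Int)
  moreover have "\<one> \<in> E \<inter> H" using E(1) H(1) subgroup.one_closed by blast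
  ultimately show ?thesis using E(3) unfolding connected_clopen by blast
qed

end

section \<open>Linear maps with spectrum on the unit circle\<close>

text \<open>The pair \<open>u + iv\<close> is an eigenvector modulo M of the complexification, with eigenvalue z.\<close>
definition unit_spectrum :: "('v::real_vector \<Rightarrow> 'v) \<Rightarrow> bool" where
  "unit_spectrum B \<longleftrightarrow> linear B \<and>
     (\<forall>M E. subspace M \<longrightarrow> subspace E \<longrightarrow> M \<subset> E \<longrightarrow> B ` M \<subseteq> M \<longrightarrow> B ` E \<subseteq> E \<longrightarrow>
       (\<exists>u\<in>E. \<exists>v\<in>E. \<exists>z. cmod z = 1 \<and> \<not> (u \<in> M \<and> v \<in> M) \<and>
          B u - (Re z *\<^sub>R u - Im z *\<^sub>R v) \<in> M \<and> B v - (Im z *\<^sub>R u + Re z *\<^sub>R v) \<in> M))"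

lemma subspace_image_eq:
  fixes B :: "'v::euclidean_space \<Rightarrow> 'v"
  assumes "linear B" "inj B" "subspace M" "B ` M \<subseteq> M"
  shows "B ` M = M"
proof (rule subspace_dim_equal)
  show "subspace (B ` M)" using assms by (simp add: linear_subspace_image)
  show "dim M \<le> dim (B ` M)"
    using dim_image_eq[of B M] assms by (metis inj_on_subset subset_UNIV order_refl)
qed (use assms in auto)

text \<open>Subspaces invariant under B' are invariant under B by dimension, and the same pair u, v
  works with the conjugate of z, which is 1 / z on the unit circle.\<close>

lemma unit_spectrum_inverse:
  fixes B :: "'v::euclidean_space \<Rightarrow> 'v"
  assumes B: "unit_spectrum B" and lin: "linear B'" and inv: "\<And>x. B (B' x) = x" "\<And>x. B' (B x) = x"
  shows "unit_spectrum B'"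
  unfolding unit_spectrum_def
proof (intro conjI allI impI lin)
  fix M E assume M: "subspace M" and E: "subspace E" and ME: "M \<subset> E"
    and B'M: "B' ` M \<subseteq> M" and B'E: "B' ` E \<subseteq> E"
  have "inj B'" by (rule inj_on_inverseI[of _ B]) (rule inv)
  note eq = subspace_image_eq[OF lin this]
  have "B ` S \<subseteq> S" if "B' ` S = S" for S
    by (subst that[symmetric]) (auto simp: inv)
  then have BM: "B ` M \<subseteq> M" and BE: "B ` E \<subseteq> E"
    using eq[OF M B'M] eq[OF E B'E] by blast+
  obtain u v z where uv: "u \<in> E" "v \<in> E" "cmod z = 1" "\<not> (u \<in> M \<and> v \<in> M)"
    "B u - (Re z *\<^sub>R u - Im z *\<^sub>R v) \<in> M" "B v - (Im z *\<^sub>R u + Re z *\<^sub>R v) \<in> M"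
    using B M E ME BM BE unfolding unit_spectrum_def by meson
  have z1: "Re z * Re z + Im z * Im z = 1"
    using uv(3) cmod_power2[of z] by (simp add: power2_eq_square)
  \<comment> \<open>Applying B' to both relations gives a linear system for B' u and B' v whose
    matrix is a rotation. Its determinant is the sum in \<open>z1\<close>, and the combinations of
    m1 and m2 below solve the system.\<close>
  define m1 where "m1 = B' (B u - (Re z *\<^sub>R u - Im z *\<^sub>R v))"
  define m2 where "m2 = B' (B v - (Im z *\<^sub>R u + Re z *\<^sub>R v))"
  have m: "m1 \<in> M" "m2 \<in> M" using uv B'M by (auto simp: m1_def m2_def)
  have m1: "m1 = u - Re z *\<^sub>R B' u + Im z *\<^sub>R B' v"
    by (simp add: m1_def linear_diff[OF lin] linear_add[OF lin] linear_scale[OF lin] inv)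
  have m2: "m2 = v - Im z *\<^sub>R B' u - Re z *\<^sub>R B' v"
    by (simp add: m2_def linear_diff[OF lin] linear_add[OF lin] linear_scale[OF lin] inv)
  have c1: "B' u = (Re z * Re z + Im z * Im z) *\<^sub>R B' u" and c2: "B' v = (Re z * Re z + Im z * Im z) *\<^sub>R B' v"
    by (simp_all add: z1)
  have "B' u - (Re z *\<^sub>R u + Im z *\<^sub>R v) = - (Re z *\<^sub>R m1 + Im z *\<^sub>R m2)"
    by (subst c1) (simp add: m1 m2 algebra_simps)
  moreover have "B' v - (Re z *\<^sub>R v - Im z *\<^sub>R u) = - (Re z *\<^sub>R m2 - Im z *\<^sub>R m1)"
    by (subst c2) (simp add: m1 m2 algebra_simps)
  moreover have "- (Re z *\<^sub>R m1 + Im z *\<^sub>R m2) \<in> M" "- (Re z *\<^sub>R m2 - Im z *\<^sub>R m1) \<in> M"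
    using m M by (auto intro!: subspace_neg subspace_add subspace_diff subspace_scale)
  ultimately have "B' u - (Re z *\<^sub>R u + Im z *\<^sub>R v) \<in> M" "B' v - (Re z *\<^sub>R v - Im z *\<^sub>R u) \<in> M"
    by simp_all
  then show "\<exists>u\<in>E. \<exists>v\<in>E. \<exists>z. cmod z = 1 \<and> \<not> (u \<in> M \<and> v \<in> M) \<and>
          B' u - (Re z *\<^sub>R u - Im z *\<^sub>R v) \<in> M \<and> B' v - (Im z *\<^sub>R u + Re z *\<^sub>R v) \<in> M"
    using uv by (intro bexI[of _ u] bexI[of _ v] exI[of _ "cnj z"]) (auto simp: algebra_simps)
qed

section \<open>Complexified vectors and products of linear factors\<close>

definition re_vec :: "complex^'n \<Rightarrow> real^'n" where "re_vec w = (\<chi> i. Re (w $ i))"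
definition im_vec :: "complex^'n \<Rightarrow> real^'n" where "im_vec w = (\<chi> i. Im (w $ i))"

lemma re_im_complexify_mat:
  "re_vec (complexify_mat M *v w) = M *v re_vec w"
  "im_vec (complexify_mat M *v w) = M *v im_vec w"
  by (simp_all add: re_vec_def im_vec_def complexify_mat_def matrix_vector_mult_def vec_eq_iff)

lemma re_im_diff: "re_vec (a - b) = re_vec a - re_vec b" "im_vec (a - b) = im_vec a - im_vec b"
  by (simp_all add: re_vec_def im_vec_def vec_eq_iff)

lemma re_im_smult:
  "re_vec (z *s w) = Re z *\<^sub>R re_vec w - Im z *\<^sub>R im_vec w"
  "im_vec (z *s w) = Im z *\<^sub>R re_vec w + Re z *\<^sub>R im_vec w"
  by (simp_all add: re_vec_def im_vec_def vec_eq_iff)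

lemma re_im_complexify_vec: "re_vec (complexify_vec v) = v" "im_vec (complexify_vec v) = 0"
  by (simp_all add: re_vec_def im_vec_def complexify_vec_def vec_eq_iff)

text \<open>A split polynomial in M, applied to w and given by the list of its roots, so that its
  linear factors can be applied one at a time.\<close>

primrec factor_op :: "complex^'n^'n \<Rightarrow> complex list \<Rightarrow> complex^'n \<Rightarrow> complex^'n" where
  "factor_op M [] w = w"
| "factor_op M (z # zs) w = factor_op M zs (M *v w - z *s w)"

lemma factor_op_add: "factor_op M zs (v + w) = factor_op M zs v + factor_op M zs w"
  by (induction zs arbitrary: v w)
    (simp_all add: matrix_vector_right_distrib vector_add_ldistrib add_diff_add)

lemma factor_op_scaleR: "factor_op M zs (c *\<^sub>R w) = c *\<^sub>R factor_op M zs w"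
proof (induction zs arbitrary: w)
  case (Cons z zs)
  have "M *v (c *\<^sub>R w) - z *s (c *\<^sub>R w) = c *\<^sub>R (M *v w - z *s w)"
    by (simp add: vec_eq_iff matrix_vector_mult_def scaleR_sum_right algebra_simps)
  then show ?case by (simp add: Cons)
qed simp

lemma factor_op_zero: "factor_op M zs 0 = 0"
  using factor_op_scaleR[of M zs 0 0] by simp

lemma factor_op_append: "factor_op M (xs @ ys) w = factor_op M ys (factor_op M xs w)"
  by (induction xs arbitrary: w) simp_all

lemma factor_op_diff_swap:
  "factor_op M zs (M *v w - z *s w) = M *v factor_op M zs w - z *s factor_op M zs w"
proof (induction zs arbitrary: w)
  case (Cons y zs)
  have "M *v (M *v w - z *s w) - y *s (M *v w - z *s w) = M *v (M *v w - y *s w) - z *s (M *v w - y *s w)"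
    by (simp add: matrix_vector_mult_diff_distrib vector_sub_rdistrib vec.scale_right_diff_distrib
        vector_scalar_commute vector_smult_assoc mult.commute algebra_simps)
  then show ?case unfolding factor_op.simps by (simp only: Cons.IH[of "M *v w - y *s w"])
qed simp

lemma factor_op_commute: "factor_op M xs (factor_op M ys w) = factor_op M ys (factor_op M xs w)"
  by (induction xs arbitrary: w) (simp_all add: factor_op_diff_swap)

lemma factor_op_replicate: "factor_op M (replicate n z) w = ((\<lambda>w. M *v w - z *s w) ^^ n) w"
  by (induction n arbitrary: w) (simp_all add: funpow_Suc_right del: funpow.simps(2))

text \<open>\<open>span\<close> is the real span, so the induction meets real scalars only. Linear
  factors in M commute, hence the concatenation of two annihilating lists annihilates the
  sum.\<close>

lemma span_gen_eigenspaces_annihilated: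
  fixes M :: "complex^'n^'n"
  assumes "w \<in> span (\<Union>z\<in>Z. gen_eigenspace M z)"
  shows "\<exists>zs. set zs \<subseteq> Z \<and> factor_op M zs w = 0"
  using assms
proof (induction rule: span_induct_alt)
  case base
  show ?case by (intro exI[of _ "[]"]) simp
next
  case (step c x y)
  obtain z where z: "z \<in> Z" "x \<in> gen_eigenspace M z" using step(1) by blast
  obtain zs where zs: "set zs \<subseteq> Z" "factor_op M zs y = 0" using step(2) by blast
  let ?r = "replicate CARD('n) z"
  have "factor_op M ?r x = 0" using z(2) by (simp add: factor_op_replicate gen_eigenspace_def)
  then have "factor_op M (?r @ zs) (c *\<^sub>R x + y) = 0"
    by (simp add: factor_op_append factor_op_add factor_op_scaleR factor_op_zero factor_op_commute[of M zs] zs(2))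
  then show ?case using z zs by (intro exI[of _ "?r @ zs"]) auto
qed

text \<open>The factors move w step by step from outside Q into Q; the vector just before entering
  is an eigenvector modulo Q. The predicate P is carried along all steps.\<close>

lemma eigenvector_modulo_subspace:
  fixes M :: "complex^'n^'n"
  assumes "P w" "\<not> Q w" "Q (factor_op M zs w)"
    and "\<And>z w. P w \<Longrightarrow> P (M *v w - z *s w)"
  shows "\<exists>w' z. z \<in> set zs \<and> P w' \<and> \<not> Q w' \<and> Q (M *v w' - z *s w')"
  using assms(1-3)
proof (induction zs arbitrary: w)
  case (Cons z zs)
  show ?case
  proof (cases "Q (M *v w - z *s w)")
    case True
    then show ?thesis using Cons.prems by auto
  next
    case False
    from Cons.IH[OF assms(4)[OF Cons.prems(1)] False] Cons.prems(3) show ?thesis by auto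
  qed
qed simp

text \<open>A real vector in E outside M is annihilated by a product of factors with roots of
  modulus 1. The predicate \<open>in_C S\<close> describes the complexification of S, so the
  eigenvector found on the way has real and imaginary parts in E.\<close>

lemma unit_spectrum_center:
  fixes L :: "real^'n::finite \<Rightarrow> real^'n"
  assumes lin: "linear L" and center: "center_subspace L = UNIV"
  shows "unit_spectrum L"
  unfolding unit_spectrum_def
proof (intro conjI allI impI lin)
  fix M E :: "(real^'n) set"
  assume M: "subspace M" and E: "subspace E" and ME: "M \<subset> E" and LM: "L ` M \<subseteq> M" and LE: "L ` E \<subseteq> E"
  define T where "T = complexify_mat (matrix L)"
  have L: "matrix L *v x = L x" for x by (simp add: lin)
  define in_C where "in_C S w \<longleftrightarrow> re_vec w \<in> S \<and> im_vec w \<in> S" for S :: "(real^'n) set" and w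
  obtain X where X: "X \<in> E" "X \<notin> M" using ME by blast
  have "X \<in> center_subspace L" by (simp add: center)
  then obtain zs where zs: "set zs \<subseteq> {z. cmod z = 1}" "factor_op T zs (complexify_vec X) = 0"
    using span_gen_eigenspaces_annihilated unfolding center_subspace_def T_def by blast
  have "\<exists>w z. z \<in> set zs \<and> in_C E w \<and> \<not> in_C M w \<and> in_C M (T *v w - z *s w)"
  proof (rule eigenvector_modulo_subspace)
    show "in_C E (complexify_vec X)" "\<not> in_C M (complexify_vec X)"
      using X subspace_0[OF E] by (auto simp: in_C_def re_im_complexify_vec)
    have "re_vec 0 = (0 :: real^'n)" "im_vec 0 = (0 :: real^'n)"
      by (simp_all add: re_vec_def im_vec_def vec_eq_iff)
    then show "in_C M (factor_op T zs (complexify_vec X))"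
      using subspace_0[OF M] by (simp add: in_C_def zs(2))
    show "in_C E (T *v w - z *s w)" if "in_C E w" for z w
      using that LE unfolding in_C_def re_im_diff re_im_smult T_def re_im_complexify_mat L
      by (auto intro!: subspace_diff[OF E] subspace_add[OF E] subspace_scale[OF E])
  qed
  then obtain w z where w: "z \<in> set zs" "in_C E w" "\<not> in_C M w" "in_C M (T *v w - z *s w)" by blast
  then show "\<exists>u\<in>E. \<exists>v\<in>E. \<exists>z. cmod z = 1 \<and> \<not> (u \<in> M \<and> v \<in> M) \<and>
          L u - (Re z *\<^sub>R u - Im z *\<^sub>R v) \<in> M \<and> L v - (Im z *\<^sub>R u + Re z *\<^sub>R v) \<in> M"
    using zs(1) unfolding in_C_def re_im_diff re_im_smult T_def re_im_complexify_mat L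
    by (intro bexI[of _ "re_vec w"] bexI[of _ "im_vec w"] exI[of _ z]) auto
qed

section \<open>Invariant semigroups in solvable groups\<close>

context topological_group
begin

lemma subgroup_closure:
  assumes H: "subgroup H G"
  shows "subgroup (closure H) G"
proof
  show "closure H \<subseteq> carrier G" by simp
  show "\<one> \<in> closure H" using subgroup.one_closed[OF H] closure_subset by blast
  show "x \<otimes> y \<in> closure H" if "x \<in> closure H" "y \<in> closure H" for x y
  proof -
    have "(\<lambda>(x, y). x \<otimes> y) ` closure (H \<times> H) \<subseteq> closure H"
      by (rule image_closure_subset[OF continuous_on_subset[OF continuous_mult]])
        (use subgroup.m_closed[OF H] closure_subset[of H] in auto)
    then show ?thesis using that by (auto simp: closure_Times)
  qed
  show "inv x \<in> closure H" if "x \<in> closure H" for x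
  proof -
    have "(\<lambda>x. inv x) ` closure H \<subseteq> closure H"
      by (rule image_closure_subset[OF continuous_on_subset[OF continuous_inv]])
        (use subgroup.m_inv_closed[OF H] closure_subset[of H] in auto)
    then show ?thesis using that by auto
  qed
qed

lemma continuous_commutator: "continuous_on UNIV (\<lambda>(x, y). x \<otimes> y \<otimes> inv x \<otimes> inv y)"
  unfolding case_prod_unfold
  by (intro continuous_on_mult_group continuous_on_inv_group continuous_intros)

lemma commutator_closure:
  assumes "x \<in> closure D" "y \<in> closure D"
  shows "x \<otimes> y \<otimes> inv x \<otimes> inv y \<in> closure (derived G D)"
proof -
  have "(\<lambda>(x, y). x \<otimes> y \<otimes> inv x \<otimes> inv y) ` closure (D \<times> D) \<subseteq> closure (derived G D)"
  proof (rule image_closure_subset[OF continuous_on_subset[OF continuous_commutator]])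
    have "(\<lambda>(x, y). x \<otimes> y \<otimes> inv x \<otimes> inv y) ` (D \<times> D) \<subseteq> derived G D"
      unfolding derived_def by (auto intro!: generate.incl)
    then show "(\<lambda>(x, y). x \<otimes> y \<otimes> inv x \<otimes> inv y) ` (D \<times> D) \<subseteq> closure (derived G D)"
      using closure_subset by blast
  qed auto
  then show ?thesis using assms by (auto simp: closure_Times)
qed

text \<open>The identity component K of the derived group is a subgroup, by maximality among
  connected subsets through the identity. The commutators form a continuous image of D \<times> D
  through the identity, so they lie in K, and they generate the derived group.\<close>

lemma connected_derived:
  assumes D: "subgroup D G" "connected D"
  shows "connected (derived G D)"
proof -
  define T where "T = derived G D"
  define K where "K = connected_component_set T \<one>"
  have T: "subgroup T G" unfolding T_def by (rule derived_is_subgroup) simp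
  have oneT: "\<one> \<in> T" by (rule subgroup.one_closed[OF T])
  have K: "\<one> \<in> K" "K \<subseteq> T" "connected K"
    using oneT by (auto simp: K_def connected_component_subset connected_component_refl_eq)
  have max: "S \<subseteq> K" if "connected S" "\<one> \<in> S" "S \<subseteq> T" for S
    unfolding K_def using that by (intro connected_component_maximal)
  have "derived_set G D \<subseteq> K"
  proof (rule max)
    have "connected ((\<lambda>(x, y). x \<otimes> y \<otimes> inv x \<otimes> inv y) ` (D \<times> D))"
      using D(2) by (intro connected_continuous_image continuous_on_subset[OF continuous_commutator] connected_Times) auto
    moreover have "(\<lambda>(x, y). x \<otimes> y \<otimes> inv x \<otimes> inv y) ` (D \<times> D) = derived_set G D" by auto
    ultimately show "connected (derived_set G D)" by simp
    show "\<one> \<in> derived_set G D"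
      using subgroup.one_closed[OF D(1)] by (auto intro!: bexI[of _ \<one>])
    show "derived_set G D \<subseteq> T" unfolding T_def derived_def by (auto intro: generate.incl)
  qed
  moreover have "subgroup K G"
  proof
    show "x \<otimes> y \<in> K" if "x \<in> K" "y \<in> K" for x y
    proof -
      have "(\<lambda>(x, y). x \<otimes> y) ` (K \<times> K) \<subseteq> K"
      proof (rule max)
        show "connected ((\<lambda>(x, y). x \<otimes> y) ` (K \<times> K))"
          using K(3) by (intro connected_continuous_image continuous_on_subset[OF continuous_mult] connected_Times) auto
        show "\<one> \<in> (\<lambda>(x, y). x \<otimes> y) ` (K \<times> K)" using K(1) by (auto intro!: image_eqI[of _ _ "(\<one>, \<one>)"])
        show "(\<lambda>(x, y). x \<otimes> y) ` (K \<times> K) \<subseteq> T" using K(2) subgroup.m_closed[OF T] by auto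
      qed
      then show ?thesis using that by auto
    qed
    show "inv x \<in> K" if "x \<in> K" for x
    proof -
      have "(\<lambda>x. inv x) ` K \<subseteq> K"
      proof (rule max)
        show "connected ((\<lambda>x. inv x) ` K)"
          using K(3) by (intro connected_continuous_image continuous_on_subset[OF continuous_inv]) auto
        show "\<one> \<in> (\<lambda>x. inv x) ` K" using K(1) by (auto intro!: image_eqI[of _ _ \<one>])
        show "(\<lambda>x. inv x) ` K \<subseteq> T" using K(2) subgroup.m_inv_closed[OF T] by auto
      qed
      then show ?thesis using that by auto
    qed
  qed (use K in auto)
  ultimately have "T \<subseteq> K" unfolding T_def derived_def by (rule generate_subgroup_incl)
  then have "T = K" using K(2) by blast
  then show ?thesis using K(3) by (simp add: T_def)
qed

end

context lie_coordinates
begin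

text \<open>The commutator condition makes M normal in E, so the n-th powers of x m and x differ by
  a right factor in M. Taking x = exp (X / k), m = exp (Z / k) and n = k, the product formula
  carries this to the limit. Congruence of vectors modulo \<open>tangent M\<close> thus becomes
  congruence in the group.\<close>

lemma expo_add_normal:
  assumes E: "subgroup E G" and M: "subgroup M G" "closed M" "M \<subseteq> E"
    and comm: "\<And>x y. x \<in> E \<Longrightarrow> y \<in> E \<Longrightarrow> x \<otimes> y \<otimes> inv x \<otimes> inv y \<in> M"
    and X: "X \<in> tangent E" and Z: "Z \<in> tangent M"
  shows "inv (expo X) \<otimes> expo (X + Z) \<in> M"
proof -
  have normal: "inv x \<otimes> m \<otimes> x \<in> M" if "x \<in> E" "m \<in> M" for x m
  proof -
    have "inv x \<otimes> m \<otimes> inv (inv x) \<otimes> inv m \<in> M"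
      using that M(3) by (intro comm subgroup.m_inv_closed[OF E]) auto
    from subgroup.m_closed[OF M(1) this that(2)] show ?thesis by (simp add: m_assoc)
  qed
  have pow: "inv (x [^] n) \<otimes> (x \<otimes> m) [^] n \<in> M" if "x \<in> E" "m \<in> M" for x m and n :: nat
  proof (induction n)
    case 0
    then show ?case by (simp add: subgroup.one_closed[OF M(1)])
  next
    case (Suc n)
    have "(inv x \<otimes> (inv (x [^] n) \<otimes> (x \<otimes> m) [^] n) \<otimes> x) \<otimes> m \<in> M"
      using normal[OF that(1) Suc] that(2) by (rule subgroup.m_closed[OF M(1)])
    then show ?case by (simp add: inv_mult_group m_assoc)
  qed
  show ?thesis
  proof (rule Lim_in_closed_set[OF M(2) _ _ tendsto_mult_group[OF tendsto_const trotter]])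
    show "\<forall>\<^sub>F k in sequentially.
        inv (expo X) \<otimes> (expo ((1 / real k) *\<^sub>R X) \<otimes> expo ((1 / real k) *\<^sub>R Z)) [^] k \<in> M"
    proof (rule eventually_sequentiallyI[of 1])
      fix k :: nat assume k: "1 \<le> k"
      have "expo X = expo ((1 / real k) *\<^sub>R X) [^] k"
        using k expo_of_nat[of k "(1 / real k) *\<^sub>R X"] by simp
      then show "inv (expo X) \<otimes> (expo ((1 / real k) *\<^sub>R X) \<otimes> expo ((1 / real k) *\<^sub>R Z)) [^] k \<in> M"
        using pow[of "expo ((1 / real k) *\<^sub>R X)" "expo ((1 / real k) *\<^sub>R Z)" k] X Z
        by (simp add: tangent_def)
    qed
  qed simp
qed

end

text \<open>Stated abstractly because it has two instances: the reachable set with h, and the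
  controllable set with h and h' exchanged. In \<open>absorb\<close> the exponent k depends on x
  alone; the condition stands in for closure of S under products.\<close>

locale contracting_set = lie_coordinates G phi psi V r C
  for G :: "('g::t2_space, 'b) monoid_scheme" (structure)
    and phi :: "'g \<Rightarrow> 'v::euclidean_space" and psi V r C +
  fixes h h' :: "'g \<Rightarrow> 'g" and B :: "'v \<Rightarrow> 'v" and S :: "'g set"
  assumes hom: "\<And>x y. h (x \<otimes> y) = h x \<otimes> h y"
    and inverse: "\<And>x. h (h' x) = x" "\<And>x. h' (h x) = x"
    and continuous: "continuous_on UNIV h" "continuous_on UNIV h'"
    and derivative: "((\<lambda>x. phi (h (psi x))) has_derivative B) (at 0)"
    and spectrum: "unit_spectrum B"
    and open_S: "open S" and one_S: "\<one> \<in> S" and h_S: "\<And>x. x \<in> S \<Longrightarrow> h x \<in> S"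
    and absorb: "\<And>x. x \<in> S \<Longrightarrow> \<exists>k. \<forall>y\<in>S. x \<otimes> (h ^^ k) y \<in> S"
begin

lemma h_one: "h \<one> = \<one>"
  using hom[of \<one> \<one>] by (metis r_cancel_one carrier_UNIV UNIV_I r_one one_closed)

lemma h_inv: "h (inv x) = inv (h x)"
proof -
  have "h x \<otimes> h (inv x) = \<one>" by (simp add: hom[symmetric] h_one)
  then show ?thesis using inv_equality[of "h (inv x)" "h x"] by (metis carrier_UNIV UNIV_I inv_comm inv_equality)
qed

lemma h_pow_mult: "(h ^^ m) (x \<otimes> y) = (h ^^ m) x \<otimes> (h ^^ m) y"
  by (induction m) (simp_all add: hom)

lemma h_pow_one: "(h ^^ m) \<one> = \<one>"
  by (induction m) (simp_all add: h_one)

lemma h_pow_inverse: "(h ^^ m) ((h' ^^ m) z) = z" "(h' ^^ m) ((h ^^ m) z) = z"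
proof -
  show "(h ^^ m) ((h' ^^ m) z) = z"
    by (induction m arbitrary: z) (simp_all add: funpow_swap1[where f = h'] inverse)
  show "(h' ^^ m) ((h ^^ m) z) = z"
    by (induction m arbitrary: z) (simp_all add: funpow_swap1[where f = h] inverse)
qed

definition core :: "'g set" where "core = (\<Inter>m. (h ^^ m) ` S)"

lemma core_subset: "core \<subseteq> S"
  unfolding core_def by (rule INF_lower2[of 0]) auto

text \<open>The image of S under h^(m + n) is among the sets intersected, so undoing h^m leaves an
  element of the core. This cancels the shift by h^k in \<open>absorb\<close>.\<close>

lemma core_root:
  assumes "x \<in> core"
  obtains y where "y \<in> core" "(h ^^ m) y = x"
proof -
  define y where "y = (h' ^^ m) x"
  have "y \<in> (h ^^ n) ` S" for n
  proof -
    obtain s where s: "s \<in> S" "x = (h ^^ (m + n)) s" using assms unfolding core_def by blast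
    then have "y = (h ^^ n) s" unfolding y_def s(2) by (simp add: funpow_add h_pow_inverse)
    then show ?thesis using s(1) by blast
  qed
  then have "y \<in> core" unfolding core_def by blast
  with that h_pow_inverse show ?thesis unfolding y_def by blast
qed

lemma mult_core:
  assumes "x \<in> S" "y \<in> core"
  shows "x \<otimes> y \<in> S"
proof -
  obtain k where k: "\<And>y. y \<in> S \<Longrightarrow> x \<otimes> (h ^^ k) y \<in> S" using absorb[OF assms(1)] by blast
  obtain z where "z \<in> core" "(h ^^ k) z = y" by (rule core_root[OF assms(2)])
  then show ?thesis using k[of z] core_subset by auto
qed

lemma h_pow_mult_core:
  assumes "x \<in> (h ^^ m) ` S" "y \<in> core"
  shows "x \<otimes> y \<in> (h ^^ m) ` S"
proof -
  obtain s where s: "s \<in> S" "x = (h ^^ m) s" using assms(1) by blast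
  obtain z where z: "z \<in> core" "(h ^^ m) z = y" by (rule core_root[OF assms(2)])
  have "x \<otimes> y = (h ^^ m) (s \<otimes> z)" using s z by (simp add: h_pow_mult)
  then show ?thesis using mult_core[OF s(1) z(1)] by blast
qed

lemma core_mult:
  assumes "x \<in> core" "y \<in> core"
  shows "x \<otimes> y \<in> core"
  unfolding core_def
proof (rule INT_I)
  fix m
  have "x \<in> (h ^^ m) ` S" using assms(1) by (simp add: core_def)
  then show "x \<otimes> y \<in> (h ^^ m) ` S" using assms(2) by (rule h_pow_mult_core)
qed

lemma one_core: "\<one> \<in> core"
  unfolding core_def using one_S h_pow_one by (metis (mono_tags) INT_I image_eqI)

lemma h_core: "x \<in> core \<Longrightarrow> h x \<in> core"
  unfolding core_def
proof (intro INT_I)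
  fix m assume "x \<in> (\<Inter>m. (h ^^ m) ` S)"
  then obtain s where "s \<in> S" "x = (h ^^ m) s" by blast
  then show "h x \<in> (h ^^ m) ` S" using h_S[of s] by (auto simp: funpow_swap1)
qed

lemma inv_h_core: "x \<in> core \<Longrightarrow> h' x \<in> core"
  by (erule core_root[of _ 1]) (auto simp: inverse)

definition core_group :: "'g set" where "core_group = {x. x \<in> core \<and> inv x \<in> core}"

lemma subgroup_core_group: "subgroup core_group G"
  by (rule subgroup.intro) (auto simp: core_group_def inv_mult_group intro: core_mult one_core)

text \<open>For x in the closure and y in the group near x, the element x y^-1 lies in the open set
  S, so x = (x y^-1) y is in S by \<open>mult_core\<close>. The closure is a subgroup mapped into
  itself by h', which promotes membership in S to membership in the core, and then to
  \<open>core_group\<close>.\<close>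

lemma closed_core_group: "closed core_group"
proof -
  have K: "subgroup (closure core_group) G" by (rule subgroup_closure[OF subgroup_core_group])
  have closure_S: "closure core_group \<subseteq> S"
  proof
    fix x assume x: "x \<in> closure core_group"
    define N where "N = (\<lambda>y. x \<otimes> inv y) -` S"
    have "continuous_on UNIV (\<lambda>y. x \<otimes> inv y)"
      by (intro continuous_on_mult_group continuous_on_inv_group continuous_intros)
    then have "open N" unfolding N_def using open_S by (simp add: open_vimage)
    moreover have "x \<in> N" using one_S by (simp add: N_def)
    ultimately obtain y where y: "y \<in> core_group" "y \<in> N"
      using x by (meson closure_iff_nhds_not_empty disjoint_iff subset_refl)
    have "(x \<otimes> inv y) \<otimes> y \<in> S"
      by (rule mult_core) (use y in \<open>auto simp: N_def core_group_def\<close>)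
    then show "x \<in> S" by (simp add: m_assoc)
  qed
  have inv_commutes: "h' (inv x) = inv (h' x)" for x
    using h_inv[of "h' x"] inverse by metis
  have "h' ` closure core_group \<subseteq> closure core_group"
  proof (rule image_closure_subset[OF continuous_on_subset[OF continuous(2)]])
    show "h' ` core_group \<subseteq> closure core_group"
      using inv_h_core closure_subset[of core_group] by (auto simp: core_group_def inv_commutes[symmetric])
  qed auto
  then have inv_h_closure: "(h' ^^ m) x \<in> closure core_group" if "x \<in> closure core_group" for m x
    using that by (induction m) auto
  have "closure core_group \<subseteq> core"
    unfolding core_def
  proof (intro subsetI INT_I)
    fix x m assume "x \<in> closure core_group"
    then have "(h' ^^ m) x \<in> S" using inv_h_closure closure_S by blast
    then show "x \<in> (h ^^ m) ` S" using h_pow_inverse(1)[of m x] by (metis image_eqI)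
  qed
  then have "x \<in> core_group" if "x \<in> closure core_group" for x
    using that subgroup.m_inv_closed[OF K that] by (subst core_group_def) blast
  then have "closure core_group \<subseteq> core_group" by blast
  then show ?thesis using closure_subset_eq by blast
qed

lemma linear_B: "linear B"
  using derivative by (rule has_derivative_linear)

lemma tangent_invariant:
  assumes "h ` E \<subseteq> E"
  shows "B ` tangent E \<subseteq> tangent E"
  using assms by (auto simp: tangent_def linear_scale[OF linear_B, symmetric]
      hom_expo[OF hom continuous(1) derivative, symmetric])

lemma h_core_group: "h ` core_group \<subseteq> core_group"
  by (auto simp: core_group_def h_inv[symmetric] intro: h_core)

text \<open>Otherwise tangent E contains the real and imaginary part of an eigenvector \<open>u + iv\<close>, modulo M, that
  are not both tangent to \<open>core_group\<close>. With \<open>w c = Re (c (u + iv))\<close> one has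
  \<open>B\<^sup>m (w c) = w (c z\<^sup>m)\<close> modulo M; as \<open>\<bar>z\<bar> = 1\<close>, small c stay small, so \<open>exp (w c)\<close> lies in the core.\<close>
lemma subset_core_group:
  assumes E: "subgroup E G" "closed E" "connected E" and hE: "h ` E \<subseteq> E"
    and comm: "\<And>x y. x \<in> E \<Longrightarrow> y \<in> E \<Longrightarrow> x \<otimes> y \<otimes> inv x \<otimes> inv y \<in> core_group"
  shows "E \<subseteq> core_group"
proof (rule ccontr)
  assume "\<not> E \<subseteq> core_group"
  then have nsub: "\<not> tangent E \<subseteq> tangent core_group"
    using subset_if_tangent_subset[OF E subgroup_core_group closed_core_group] by blast
  \<comment> \<open>Intersecting with E gives a subgroup of E, as \<open>expo_add_normal\<close>
    requires, whose tangent space is properly contained in that of E by \<open>nsub\<close>.\<close>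
  define N where "N = E \<inter> core_group"
  have N: "subgroup N G" "closed N" "N \<subseteq> E" "N \<subseteq> core_group"
    using subgroups_Inter_pair[OF E(1) subgroup_core_group] E(2) closed_core_group by (auto simp: N_def)
  have commN: "x \<otimes> y \<otimes> inv x \<otimes> inv y \<in> N" if "x \<in> E" "y \<in> E" for x y
    unfolding N_def using that comm
    by (auto intro!: subgroup.m_closed[OF E(1)] subgroup.m_inv_closed[OF E(1)])
  define M where "M = tangent N"
  have M_eq: "M = tangent E \<inter> tangent core_group" by (auto simp: M_def N_def tangent_def)
  have subE: "subspace (tangent E)" by (rule subspace_tangent[OF E(1,2)])
  have subM: "subspace M" unfolding M_def by (rule subspace_tangent[OF N(1,2)])
  have "B ` M \<subseteq> M" unfolding M_def
    by (rule tangent_invariant) (use hE h_core_group in \<open>auto simp: N_def\<close>)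
  moreover have "B ` tangent E \<subseteq> tangent E" by (rule tangent_invariant[OF hE])
  moreover have "M \<subset> tangent E" using nsub M_eq by blast
  ultimately obtain u v z where uv: "u \<in> tangent E" "v \<in> tangent E" "cmod z = 1" "\<not> (u \<in> M \<and> v \<in> M)"
    "B u - (Re z *\<^sub>R u - Im z *\<^sub>R v) \<in> M" "B v - (Im z *\<^sub>R u + Re z *\<^sub>R v) \<in> M"
    using spectrum subE subM unfolding unit_spectrum_def by meson
  note BM = \<open>B ` M \<subseteq> M\<close>
  define w where "w c = Re c *\<^sub>R u - Im c *\<^sub>R v" for c
  have wE: "w c \<in> tangent E" for c
    unfolding w_def by (intro subspace_diff[OF subE] subspace_scale[OF subE] uv)
  have step: "B (w c) - w (c * z) \<in> M" for c
  proof -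
    have "B (w c) - w (c * z) = Re c *\<^sub>R (B u - (Re z *\<^sub>R u - Im z *\<^sub>R v)) - Im c *\<^sub>R (B v - (Im z *\<^sub>R u + Re z *\<^sub>R v))"
      by (simp add: w_def linear_diff[OF linear_B] linear_scale[OF linear_B] algebra_simps)
    also have "\<dots> \<in> M" by (intro subspace_diff[OF subM] subspace_scale[OF subM] uv)
    finally show ?thesis .
  qed
  have iterate: "(B ^^ m) (w c) - w (c * z ^ m) \<in> M" for m c
  proof (induction m)
    case 0
    then show ?case using subspace_0[OF subM] by simp
  next
    case (Suc m)
    have "B ((B ^^ m) (w c) - w (c * z ^ m)) + (B (w (c * z ^ m)) - w (c * z ^ m * z)) \<in> M"
      using Suc BM step by (intro subspace_add[OF subM]) auto
    then show ?case by (simp add: linear_diff[OF linear_B] mult_ac)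
  qed
  have h_pow_expo: "(h ^^ m) (expo X) = expo ((B ^^ m) X)" for m X
    by (induction m) (simp_all add: hom_expo[OF hom continuous(1) derivative])
  have BE: "(B ^^ m) (w c) \<in> tangent E" for m c
    using \<open>B ` tangent E \<subseteq> tangent E\<close> by (induction m) (auto simp: wE)
  have contw: "continuous_on UNIV (\<lambda>c. expo (w c))"
    unfolding w_def by (intro continuous_on_expo continuous_intros)
  have "open ((\<lambda>c. expo (w c)) -` S)" using contw open_S by (simp add: open_vimage)
  moreover have "0 \<in> (\<lambda>c. expo (w c)) -` S" using one_S by (simp add: w_def expo_zero)
  ultimately obtain d where d: "d > 0" and ball_d: "ball 0 d \<subseteq> (\<lambda>c. expo (w c)) -` S"
    by (rule openE)
  have expo_S: "expo (w c) \<in> S" if "cmod c < d" for c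
    using subsetD[OF ball_d, of c] that by simp
  have small: "expo (w c) \<in> core" if c: "cmod c < d" for c
    unfolding core_def
  proof (rule INT_I)
    fix m
    \<comment> \<open>The parameter is rotated back so that m applications of B lead to w c modulo
      M. Its modulus is unchanged, hence the radius d serves every m.\<close>
    define c' where "c' = c / z ^ m"
    have "z \<noteq> 0" using uv(3) by auto
    then have c': "c' * z ^ m = c" by (simp add: c'_def)
    have "cmod c' < d" using c uv(3) by (simp add: c'_def norm_divide norm_power)
    then have "expo (w c') \<in> S" by (rule expo_S)
    then have 1: "(h ^^ m) (expo (w c')) \<in> (h ^^ m) ` S" by blast
    define X where "X = (B ^^ m) (w c')"
    \<comment> \<open>With w c = X + (w c - X) and the second summand tangent to N, exp (w c) is exp
      X, an element of the image of S under h^m, times an element of the core.\<close>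
    have "- (X - w c) \<in> M" using subspace_neg[OF subM iterate[of m c']] by (simp add: X_def c')
    then have "w c - X \<in> tangent N" by (simp add: M_def)
    from expo_add_normal[OF E(1) N(1,2,3) commN BE[of m c', folded X_def] this]
    have "inv (expo X) \<otimes> expo (w c) \<in> core" using N(4) by (auto simp: core_group_def)
    from h_pow_mult_core[OF 1 this] show "expo (w c) \<in> (h ^^ m) ` S"
      by (simp add: h_pow_expo X_def m_assoc[symmetric])
  qed
  \<comment> \<open>The core is a semigroup, so taking powers extends the statement from the disc of
    radius d to the whole plane.\<close>
  have all: "expo (w c) \<in> core" for c
  proof -
    obtain n where n: "cmod c < real n * d" using reals_Archimedean3[OF d] by blast
    then have n0: "n > 0" by (cases "n = 0") auto
    define c' where "c' = c / of_nat n"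
    have "cmod c' < d" using n n0 by (simp add: c'_def norm_divide field_simps)
    then have c': "expo (w c') \<in> core" by (rule small)
    have "w c = real n *\<^sub>R w c'" using n0 by (simp add: w_def c'_def scaleR_diff_right)
    then have "expo (w c) = expo (w c') [^] n" by (simp add: expo_of_nat)
    moreover have "expo (w c') [^] k \<in> core" for k :: nat
      by (induction k) (auto intro: one_core core_mult c')
    ultimately show ?thesis by simp
  qed
  have kern: "expo (w c) \<in> core_group" for c
  proof -
    have "w (- c) = - w c" by (simp add: w_def)
    then show ?thesis using all[of c] all[of "- c"] by (simp add: core_group_def expo_minus)
  qed
  have "u \<in> tangent core_group" unfolding tangent_def
    using kern[of "complex_of_real _"] by (auto simp: w_def)
  moreover have "v \<in> tangent core_group" unfolding tangent_def
  proof (intro CollectI allI)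
    \<comment> \<open>The parameter - i t gives w (- i t) = t v.\<close>
    show "expo (t *\<^sub>R v) \<in> core_group" for t using kern[of "Complex 0 (- t)"] by (simp add: w_def)
  qed
  ultimately show False using uv M_eq by blast
qed

theorem S_eq_UNIV:
  assumes conn: "connected (UNIV :: 'g set)" and solv: "solvable G"
  shows "S = UNIV"
proof -
  define D where "D i = (derived G ^^ i) UNIV" for i
  have D: "subgroup (D i) G" for i
    unfolding D_def using exp_of_derived_is_subgroup[OF subgroup_self] by simp
  have D_Suc: "D (Suc i) = derived G (D i)" for i by (simp add: D_def)
  obtain n where n: "D n = {\<one>}"
    using solvable_imp_trivial_derived_seq[of "carrier G"] solv unfolding solvable_def D_def by auto
  have connD: "connected (D i)" for i
  proof (induction i)
    case 0
    then show ?case using conn by (simp add: D_def)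
  next
    case (Suc i)
    then show ?case using connected_derived[OF D] D_Suc by simp
  qed
  interpret gh: group_hom G G h by unfold_locales (auto simp: hom_def hom)
  have hD: "h ` D i \<subseteq> D i" for i
  proof -
    have "(derived G ^^ i) (h ` UNIV) = h ` (derived G ^^ i) UNIV"
      by (rule gh.exp_of_derived_img) simp
    moreover have "(derived G ^^ i) (h ` UNIV) \<subseteq> (derived G ^^ i) UNIV"
      by (rule mono_exp_of_derived) simp
    ultimately show ?thesis by (simp add: D_def)
  qed
  \<comment> \<open>The derived series is climbed from the trivial group at j = 0 to the whole group
    at j = n; the bound on j keeps the truncated subtraction exact.\<close>
  have "closure (D (n - j)) \<subseteq> core_group" if "j \<le> n" for j
    using that
  proof (induction j)
    case 0
    then show ?case using subgroup.one_closed[OF subgroup_core_group] by (simp add: n)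
  next
    case (Suc j)
    define i where "i = n - Suc j"
    have i: "Suc i = n - j" using Suc.prems by (simp add: i_def)
    have "closure (D i) \<subseteq> core_group"
    proof (rule subset_core_group)
      show "subgroup (closure (D i)) G" by (rule subgroup_closure[OF D])
      show "connected (closure (D i))" by (rule connected_imp_connected_closure[OF connD])
      show "h ` closure (D i) \<subseteq> closure (D i)"
        by (rule image_closure_subset[OF continuous_on_subset[OF continuous(1)]])
          (use hD closure_subset in blast)+
      show "x \<otimes> y \<otimes> inv x \<otimes> inv y \<in> core_group" if "x \<in> closure (D i)" "y \<in> closure (D i)" for x y
        using commutator_closure[OF that] Suc i D_Suc[of i] by auto
    qed simp
    then show ?case by (simp add: i_def)
  qed
  from this[of n] have "core_group = UNIV" by (auto simp: D_def)
  then show ?thesis using core_subset by (auto simp: core_group_def)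
qed

end

section \<open>From charts to group coordinates\<close>

lemma smooth_on_imp_continuous_on:
  assumes "smooth_on S f"
  shows "continuous_on S f"
proof -
  from assms obtain D where D: "\<And>x. x \<in> S \<Longrightarrow> D [] x = f x"
    "\<And>x. x \<in> S \<Longrightarrow> ((D []) has_derivative (\<lambda>v. D [v] x)) (at x)"
    unfolding smooth_on_def by blast
  have "continuous_on S (D [])"
    using D(2) by (intro continuous_at_imp_continuous_on) (auto intro: has_derivative_continuous)
  then show ?thesis using D(1) by (simp cong: continuous_on_cong)
qed

lemma smooth_on_imp_differentiable:
  assumes "smooth_on S f" "x \<in> S"
  obtains f' where "(f has_derivative f') (at x)"
proof -
  obtain f' r C where "r > 0" "\<And>y. y \<in> cball x r \<Longrightarrow> (f has_derivative f' y) (at y)"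
    using smooth_on_lipschitz_derivative[OF assms] by metis
  then show ?thesis using that[of "f' x"] by simp
qed

lemma chartD:
  assumes "is_chart (U, \<phi>, \<psi>)"
  shows "open U" "open (\<phi> ` U)" "continuous_on U \<phi>" "continuous_on (\<phi> ` U) \<psi>"
    "\<And>x. x \<in> U \<Longrightarrow> \<psi> (\<phi> x) = x" "\<And>y. y \<in> \<phi> ` U \<Longrightarrow> \<psi> y \<in> U" "\<And>y. y \<in> \<phi> ` U \<Longrightarrow> \<phi> (\<psi> y) = y"
  using assms unfolding is_chart_def homeomorphism_def by auto

lemma lie_groupD:
  assumes "lie_group G A"
  shows "group G" "carrier G = UNIV" "\<And>U \<phi> \<psi>. (U, \<phi>, \<psi>) \<in> A \<Longrightarrow> is_chart (U, \<phi>, \<psi>)"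
    "\<And>x. \<exists>U \<phi> \<psi>. (U, \<phi>, \<psi>) \<in> A \<and> x \<in> U"
    "\<And>U1 \<phi>1 \<psi>1 U2 \<phi>2 \<psi>2 U3 \<phi>3 \<psi>3. (U1, \<phi>1, \<psi>1) \<in> A \<Longrightarrow> (U2, \<phi>2, \<psi>2) \<in> A \<Longrightarrow> (U3, \<phi>3, \<psi>3) \<in> A \<Longrightarrow>
        smooth_on {(x, y). x \<in> \<phi>1 ` U1 \<and> y \<in> \<phi>2 ` U2 \<and> \<psi>1 x \<otimes>\<^bsub>G\<^esub> \<psi>2 y \<in> U3}
                  (\<lambda>(x, y). \<phi>3 (\<psi>1 x \<otimes>\<^bsub>G\<^esub> \<psi>2 y))"
    "\<And>U1 \<phi>1 \<psi>1 U2 \<phi>2 \<psi>2. (U1, \<phi>1, \<psi>1) \<in> A \<Longrightarrow> (U2, \<phi>2, \<psi>2) \<in> A \<Longrightarrow>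
        smooth_on {x. x \<in> \<phi>1 ` U1 \<and> inv\<^bsub>G\<^esub> (\<psi>1 x) \<in> U2} (\<lambda>x. \<phi>2 (inv\<^bsub>G\<^esub> (\<psi>1 x)))"
proof -
  note a = assms[unfolded lie_group_def]
  show "group G" "carrier G = UNIV" using a by auto
  show "is_chart (U, \<phi>, \<psi>)" if "(U, \<phi>, \<psi>) \<in> A" for U \<phi> \<psi> using a that by blast
  show "\<exists>U \<phi> \<psi>. (U, \<phi>, \<psi>) \<in> A \<and> x \<in> U" for x using a by fast
  show "smooth_on {(x, y). x \<in> \<phi>1 ` U1 \<and> y \<in> \<phi>2 ` U2 \<and> \<psi>1 x \<otimes>\<^bsub>G\<^esub> \<psi>2 y \<in> U3}
                  (\<lambda>(x, y). \<phi>3 (\<psi>1 x \<otimes>\<^bsub>G\<^esub> \<psi>2 y))"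
    if "(U1, \<phi>1, \<psi>1) \<in> A" "(U2, \<phi>2, \<psi>2) \<in> A" "(U3, \<phi>3, \<psi>3) \<in> A" for U1 \<phi>1 \<psi>1 U2 \<phi>2 \<psi>2 U3 \<phi>3 \<psi>3
    using a that by fast
  show "smooth_on {x. x \<in> \<phi>1 ` U1 \<and> inv\<^bsub>G\<^esub> (\<psi>1 x) \<in> U2} (\<lambda>x. \<phi>2 (inv\<^bsub>G\<^esub> (\<psi>1 x)))"
    if "(U1, \<phi>1, \<psi>1) \<in> A" "(U2, \<phi>2, \<psi>2) \<in> A" for U1 \<phi>1 \<psi>1 U2 \<phi>2 \<psi>2
    using a that by fast
qed

text \<open>The axioms speak of coordinate expressions only. Locally the product is such an
  expression composed with charts, on a set N that is open because \<open>smooth_on\<close> includes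
  openness of the domain.\<close>

lemma lie_group_topological_group:
  assumes L: "lie_group G A"
  shows "topological_group G"
proof -
  note D = lie_groupD[OF L]
  interpret group G by (rule D(1))
  show ?thesis
  proof
    show "carrier G = UNIV" by (rule D(2))
    show "continuous_on UNIV (\<lambda>(x, y). x \<otimes>\<^bsub>G\<^esub> y)"
    proof (rule continuous_at_imp_continuous_on, rule ballI)
      fix ab :: "'a \<times> 'a"
      obtain a b where ab: "ab = (a, b)" by (cases ab)
      obtain U1 \<phi>1 \<psi>1 where 1: "(U1, \<phi>1, \<psi>1) \<in> A" "a \<in> U1" using D(4) by blast
      obtain U2 \<phi>2 \<psi>2 where 2: "(U2, \<phi>2, \<psi>2) \<in> A" "b \<in> U2" using D(4) by blast
      obtain U3 \<phi>3 \<psi>3 where 3: "(U3, \<phi>3, \<psi>3) \<in> A" "a \<otimes>\<^bsub>G\<^esub> b \<in> U3" using D(4) by blast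
      note c1 = chartD[OF D(3)[OF 1(1)]] and c2 = chartD[OF D(3)[OF 2(1)]] and c3 = chartD[OF D(3)[OF 3(1)]]
      define S where "S = {(x, y). x \<in> \<phi>1 ` U1 \<and> y \<in> \<phi>2 ` U2 \<and> \<psi>1 x \<otimes>\<^bsub>G\<^esub> \<psi>2 y \<in> U3}"
      define F where "F = (\<lambda>(x, y). \<phi>3 (\<psi>1 x \<otimes>\<^bsub>G\<^esub> \<psi>2 y))"
      have sm: "smooth_on S F" unfolding S_def F_def by (rule D(5)[OF 1(1) 2(1) 3(1)])
      then have S: "open S" by (simp add: smooth_on_def)
      define q where "q = (\<lambda>(g, h). (\<phi>1 g, \<phi>2 h))"
      have q: "continuous_on (U1 \<times> U2) q"
        unfolding q_def case_prod_unfold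
        by (intro continuous_intros continuous_on_compose2[OF c1(3) continuous_on_fst[OF continuous_on_id]]
            continuous_on_compose2[OF c2(3) continuous_on_snd[OF continuous_on_id]]) auto
      define N where "N = (U1 \<times> U2) \<inter> q -` S"
      have N: "open N" unfolding N_def
        by (rule continuous_open_preimage[OF q _ S]) (intro open_Times c1 c2)
      have F: "\<psi>3 (F (q (g, h))) = g \<otimes>\<^bsub>G\<^esub> h" if "(g, h) \<in> N" for g h
      proof -
        have m: "g \<in> U1" "h \<in> U2" "\<psi>1 (\<phi>1 g) \<otimes>\<^bsub>G\<^esub> \<psi>2 (\<phi>2 h) \<in> U3"
          using that by (simp_all add: N_def q_def S_def)
        show ?thesis
          using c3(5)[OF m(3)] c1(5)[OF m(1)] c2(5)[OF m(2)] by (simp add: F_def q_def)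
      qed
      have "continuous_on N (\<lambda>p. F (q p))"
        by (rule continuous_on_compose2[OF smooth_on_imp_continuous_on[OF sm]])
          (auto simp: N_def intro: continuous_on_subset[OF q])
      then have "continuous_on N (\<lambda>p. \<psi>3 (F (q p)))"
        by (rule continuous_on_compose2[OF c3(4)])
          (use c1(5) c2(5) in \<open>auto simp: N_def F_def q_def S_def\<close>)
      then have "continuous_on N (\<lambda>(x, y). x \<otimes>\<^bsub>G\<^esub> y)"
        by (rule continuous_on_eq) (use F in auto)
      moreover have "ab \<in> N"
        using 1 2 3 c1(5) c2(5) by (simp add: N_def q_def S_def ab)
      ultimately show "isCont (\<lambda>(x, y). x \<otimes>\<^bsub>G\<^esub> y) ab"
        using N by (simp add: continuous_on_eq_continuous_at)
    qed
    show "continuous_on UNIV (\<lambda>x. inv\<^bsub>G\<^esub> x)"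
    proof (rule continuous_at_imp_continuous_on, rule ballI)
      fix a :: 'a
      obtain U1 \<phi>1 \<psi>1 where 1: "(U1, \<phi>1, \<psi>1) \<in> A" "a \<in> U1" using D(4) by blast
      obtain U2 \<phi>2 \<psi>2 where 2: "(U2, \<phi>2, \<psi>2) \<in> A" "inv\<^bsub>G\<^esub> a \<in> U2" using D(4) by blast
      note c1 = chartD[OF D(3)[OF 1(1)]] and c2 = chartD[OF D(3)[OF 2(1)]]
      define S where "S = {x. x \<in> \<phi>1 ` U1 \<and> inv\<^bsub>G\<^esub> (\<psi>1 x) \<in> U2}"
      define F where "F = (\<lambda>x. \<phi>2 (inv\<^bsub>G\<^esub> (\<psi>1 x)))"
      have sm: "smooth_on S F" unfolding S_def F_def by (rule D(6)[OF 1(1) 2(1)])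
      then have S: "open S" by (simp add: smooth_on_def)
      define N where "N = U1 \<inter> \<phi>1 -` S"
      have N: "open N" unfolding N_def by (rule continuous_open_preimage[OF c1(3) c1(1) S])
      have NU: "x \<in> U1" "inv\<^bsub>G\<^esub> x \<in> U2" if "x \<in> N" for x
      proof -
        show x: "x \<in> U1" using that by (simp add: N_def)
        show "inv\<^bsub>G\<^esub> x \<in> U2" using that c1(5)[OF x] by (simp add: N_def S_def)
      qed
      have "continuous_on N (\<lambda>p. F (\<phi>1 p))"
        by (rule continuous_on_compose2[OF smooth_on_imp_continuous_on[OF sm]])
          (auto simp: N_def intro: continuous_on_subset[OF c1(3)])
      then have "continuous_on N (\<lambda>p. \<psi>2 (F (\<phi>1 p)))"
        by (rule continuous_on_compose2[OF c2(4)])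
          (use c1(5) NU in \<open>auto simp: F_def\<close>)
      then have "continuous_on N (\<lambda>x. inv\<^bsub>G\<^esub> x)"
        by (rule continuous_on_eq) (use c1(5) c2(5) NU in \<open>auto simp: F_def\<close>)
      moreover have "a \<in> N" using 1 2 c1(5) by (simp add: N_def S_def)
      ultimately show "isCont (\<lambda>x. inv\<^bsub>G\<^esub> x) a"
        using N by (simp add: continuous_on_eq_continuous_at)
    qed
  qed
qed

text \<open>In the second-difference bound, y' = p, the coordinate of the identity, turns the
  subtracted terms into x - x', and x' = p gives the other estimate. The constant is C + 1 because
  the locale asks for a positive one.\<close>

lemma lie_group_coordinates:
  assumes L: "lie_group G A" and chart: "(U, \<phi>, \<psi>) \<in> A" "\<one>\<^bsub>G\<^esub> \<in> U"
  obtains r C where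
    "lie_coordinates G (\<lambda>g. \<phi> g - \<phi> \<one>\<^bsub>G\<^esub>) (\<lambda>x. \<psi> (x + \<phi> \<one>\<^bsub>G\<^esub>)) U r C"
proof -
  note D = lie_groupD[OF L]
  interpret topological_group G by (rule lie_group_topological_group[OF L])
  note c = chartD[OF D(3)[OF chart(1)]]
  define p where "p = \<phi> \<one>\<^bsub>G\<^esub>"
  define S where "S = {(x, y). x \<in> \<phi> ` U \<and> y \<in> \<phi> ` U \<and> \<psi> x \<otimes>\<^bsub>G\<^esub> \<psi> y \<in> U}"
  have psi_p: "\<psi> p = \<one>\<^bsub>G\<^esub>" using c(5) chart(2) by (simp add: p_def)
  have sm: "smooth_on S (\<lambda>(x, y). \<phi> (\<psi> x \<otimes>\<^bsub>G\<^esub> \<psi> y))"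
    unfolding S_def by (rule D(5)[OF chart(1) chart(1) chart(1)])
  have "(p, p) \<in> S" using chart(2) psi_p by (auto simp: S_def p_def)
  then obtain r C where r: "r > 0" "C \<ge> 0" "ball p r \<times> ball p r \<subseteq> S"
    "\<And>x x' y y'. x \<in> ball p r \<Longrightarrow> x' \<in> ball p r \<Longrightarrow> y \<in> ball p r \<Longrightarrow> y' \<in> ball p r \<Longrightarrow>
       norm (\<phi> (\<psi> x \<otimes>\<^bsub>G\<^esub> \<psi> y) - \<phi> (\<psi> x' \<otimes>\<^bsub>G\<^esub> \<psi> y) - (\<phi> (\<psi> x \<otimes>\<^bsub>G\<^esub> \<psi> y') - \<phi> (\<psi> x' \<otimes>\<^bsub>G\<^esub> \<psi> y')))
         \<le> C * norm (x - x') * norm (y - y')"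
    by (rule second_difference_estimate[OF sm]) (rule that; assumption)
  have S: "(x, y) \<in> S" if "x \<in> ball p r" "y \<in> ball p r" for x y using r(3) that by blast
  have b: "x + p \<in> ball p r" if "norm x < r" for x using that by (simp add: dist_norm)
  have pb: "p \<in> ball p r" using r(1) by simp
  have ball_U: "x \<in> \<phi> ` U" if "x \<in> ball p r" for x using S[OF that that] by (simp add: S_def)
  show ?thesis
  proof (rule that[of r "C + 1"], unfold p_def[symmetric], unfold_locales)
    show "open U" "\<one>\<^bsub>G\<^esub> \<in> U" "\<phi> \<one>\<^bsub>G\<^esub> - p = 0" "r > 0" "C + 1 > 0"
      using c chart r by (auto simp: p_def)
    show "continuous_on U (\<lambda>g. \<phi> g - p)" by (intro continuous_intros c)
    show "continuous_on (ball 0 r) (\<lambda>x. \<psi> (x + p))"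
      by (rule continuous_on_compose2[OF c(4)]) (use ball_U b in \<open>auto intro!: continuous_intros\<close>)
    show "\<psi> (x + p) \<in> U" "\<phi> (\<psi> (x + p)) - p = x" if "norm x < r" for x
      using c(6,7) ball_U[OF b[OF that]] by auto
    show "\<psi> (\<phi> g - p + p) = g" if "g \<in> U" for g using c(5) that by simp
    show "\<psi> (x + p) \<otimes>\<^bsub>G\<^esub> \<psi> (y + p) \<in> U" if "norm x < r" "norm y < r" for x y
      using S[OF b b, OF that] by (simp add: S_def)
    have inv_coord: "\<phi> (\<psi> (x + p)) = x + p" if "norm x < r" for x
      using c(7) ball_U[OF b[OF that]] by blast
    have weaken: "C * s * t \<le> (C + 1) * s * t" if "s \<ge> 0" "t \<ge> 0" for s t
      using that by (intro mult_right_mono) auto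
    show "norm (\<phi> (\<psi> (x + p) \<otimes>\<^bsub>G\<^esub> \<psi> (y + p)) - p - (\<phi> (\<psi> (x' + p) \<otimes>\<^bsub>G\<^esub> \<psi> (y + p)) - p) - (x - x'))
        \<le> (C + 1) * norm y * norm (x - x')" if h: "norm x < r" "norm x' < r" "norm y < r" for x x' y
    proof -
      have "norm (\<phi> (\<psi> (x + p) \<otimes>\<^bsub>G\<^esub> \<psi> (y + p)) - \<phi> (\<psi> (x' + p) \<otimes>\<^bsub>G\<^esub> \<psi> (y + p)) - (x - x'))
        \<le> C * norm (x - x') * norm y"
        using r(4)[OF b b b pb, OF h] by (simp add: psi_p inv_coord h)
      with weaken[of "norm (x - x')" "norm y"] show ?thesis by (simp add: mult_ac)
    qed
    show "norm (\<phi> (\<psi> (x + p) \<otimes>\<^bsub>G\<^esub> \<psi> (y + p)) - p - (\<phi> (\<psi> (x + p) \<otimes>\<^bsub>G\<^esub> \<psi> (y' + p)) - p) - (y - y'))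
        \<le> (C + 1) * norm x * norm (y - y')" if h: "norm x < r" "norm y < r" "norm y' < r" for x y y'
    proof -
      have bound: "norm (\<phi> (\<psi> (x + p) \<otimes>\<^bsub>G\<^esub> \<psi> (y + p)) - y - (\<phi> (\<psi> (x + p) \<otimes>\<^bsub>G\<^esub> \<psi> (y' + p)) - y'))
        \<le> C * norm x * norm (y - y')"
        using r(4)[OF b pb b b, OF h] inv_coord[OF h(2)] inv_coord[OF h(3)]
        by (simp add: psi_p algebra_simps)
      have eq: "\<phi> (\<psi> (x + p) \<otimes>\<^bsub>G\<^esub> \<psi> (y + p)) - p - (\<phi> (\<psi> (x + p) \<otimes>\<^bsub>G\<^esub> \<psi> (y' + p)) - p) - (y - y')
          = \<phi> (\<psi> (x + p) \<otimes>\<^bsub>G\<^esub> \<psi> (y + p)) - y - (\<phi> (\<psi> (x + p) \<otimes>\<^bsub>G\<^esub> \<psi> (y' + p)) - y')"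
        by simp
      show ?thesis unfolding eq by (rule order_trans[OF bound weaken]) simp_all
    qed
  qed
qed

text \<open>The chain rule for k after h. In coordinates the composite is known to be the identity
  only near 0, where h (psi x) remains in the chart domain.\<close>

lemma (in lie_coordinates) inverse_derivative:
  assumes one: "h \<one> = \<one>" and cont: "continuous_on UNIV h" and inv: "\<And>x. k (h x) = x"
    and B: "((\<lambda>x. phi (h (psi x))) has_derivative B) (at 0)"
    and B': "((\<lambda>x. phi (k (psi x))) has_derivative B') (at 0)"
  shows "B' (B x) = x"
proof -
  have "phi (h (psi 0)) = 0" by (simp add: psi_zero one phi_one)
  with has_derivative_compose[OF B, of "\<lambda>x. phi (k (psi x))" B'] B'
  have comp: "((\<lambda>x. phi (k (psi (phi (h (psi x)))))) has_derivative (\<lambda>x. B' (B x))) (at 0)" by simp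
  have "((\<lambda>x. psi x) \<longlongrightarrow> \<one>) (at 0)"
    using tendsto_psi[of "\<lambda>x. x" 0 "at 0"] r_pos by (simp add: psi_zero)
  from continuous_on_tendsto_compose[OF cont this]
  have "((\<lambda>x. h (psi x)) \<longlongrightarrow> \<one>) (at 0)" by (simp add: one)
  then have "\<forall>\<^sub>F x in at 0. h (psi x) \<in> V" by (rule eventually_V)
  moreover have "\<forall>\<^sub>F x in at 0. norm (x::'v) < r"
    unfolding eventually_at using r_pos by (auto intro!: exI[of _ r])
  ultimately have "\<forall>\<^sub>F x in at 0. phi (k (psi (phi (h (psi x))))) = x"
    by eventually_elim (simp add: psi_phi inv phi_psi)
  moreover have "phi (k (psi (phi (h (psi 0))))) = 0"
    using inv[of \<one>] by (simp add: psi_zero one phi_one)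
  ultimately have "((\<lambda>x. x) has_derivative (\<lambda>x. B' (B x))) (at 0)"
    by (intro has_derivative_transform_eventually[OF comp]) auto
  from has_derivative_unique[OF this has_derivative_ident] show ?thesis by metis
qed

section \<open>Trajectories and controllability\<close>

lemma traj_append:
  "traj f (k + l) g (\<lambda>i. if i < k then u i else v (i - k)) = traj f l (traj f k g u) v"
proof -
  have "traj f j g (\<lambda>i. if i < k then u i else v (i - k)) = traj f j g u" if "j \<le> k" for j
    using that by (induction j) auto
  then show ?thesis by (induction l) auto
qed

text \<open>Each step multiplies on the left by an element depending only on the control, so the
  initial value is merely moved by h^k. This is the source of \<open>absorb\<close>.\<close>

lemma traj_affine:
  assumes G: "group G" "carrier G = UNIV"
    and f: "\<And>u g. u \<in> U \<Longrightarrow> f g u = f \<one>\<^bsub>G\<^esub> u \<otimes>\<^bsub>G\<^esub> h g"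
    and hom: "\<And>x y. h (x \<otimes>\<^bsub>G\<^esub> y) = h x \<otimes>\<^bsub>G\<^esub> h y" and u: "\<And>i. u i \<in> U"
  shows "traj f k g u = traj f k \<one>\<^bsub>G\<^esub> u \<otimes>\<^bsub>G\<^esub> (h ^^ k) g"
proof -
  interpret group G by (rule G)
  show ?thesis
  proof (induction k)
    case 0
    then show ?case by (simp add: G)
  next
    case (Suc k)
    then show ?case
      using f[OF u, of "traj f k g u" k] f[OF u, of "traj f k \<one>\<^bsub>G\<^esub> u" k] by (simp add: hom m_assoc G)
  qed
qed

theorem theorem3p4:
  fixes G :: "('g::t2_space, 'b) monoid_scheme"
    and A :: "('g, 'n::finite) chart set"
    and f :: "'g \<Rightarrow> real^'m::finite \<Rightarrow> 'g"
    and U :: "(real^'m) set"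
  assumes "lie_group G A"
    and "connected (UNIV :: 'g set)"
    and "solvable G"
    and "linear_system G A f U"
    and "open (reachable_set f U \<one>\<^bsub>G\<^esub>)"
    and "open (controllable_set f U \<one>\<^bsub>G\<^esub>)"
    and "center_full G A (\<lambda>g. f g 0)"
  shows "controllable f U"
proof -
  define h where "h = (\<lambda>g. f g 0)"
  define h' where "h' = inv_into UNIV h"
  define e where "e = \<one>\<^bsub>G\<^esub>"
  interpret topological_group G by (rule lie_group_topological_group[OF assms(1)])
  note system = assms(4)[unfolded linear_system_def, folded h_def e_def]
  have U0: "0 \<in> U" using system interior_subset[of U] by blast
  have lie_auto: "lie_automorphism G A h" using system by blast
  have f: "f g u = f e u \<otimes>\<^bsub>G\<^esub> h g" if "u \<in> U" for u g
    using system that unfolding h_def by blast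
  have sm: "smooth_map A h" "smooth_map A h'" and iso: "h \<in> iso G G"
    using lie_auto unfolding lie_automorphism_def h'_def by auto
  have hom: "h (x \<otimes>\<^bsub>G\<^esub> y) = h x \<otimes>\<^bsub>G\<^esub> h y" for x y
    using iso by (simp add: iso_def hom_def)
  have "bij h" using iso by (simp add: iso_def)
  then have inverse: "h (h' x) = x" "h' (h x) = x" for x
    by (simp_all add: h'_def bij_is_inj bij_is_surj surj_f_inv_f)
  have hom': "h' (x \<otimes>\<^bsub>G\<^esub> y) = h' x \<otimes>\<^bsub>G\<^esub> h' y" for x y
    using hom[of "h' x" "h' y"] inverse by metis
  have one: "h e = e" "h' e = e"
    using hom[of e e] hom'[of e e] by (metis r_cancel_one carrier_UNIV UNIV_I r_one one_closed e_def)+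
  have cont: "continuous_on UNIV h" "continuous_on UNIV h'" using sm by (auto simp: smooth_map_def)
  obtain V \<phi> \<psi> L where chart: "(V, \<phi>, \<psi>) \<in> A" "e \<in> V"
    and L: "((\<lambda>x. \<phi> (h (\<psi> x))) has_derivative L) (at (\<phi> e))" and center: "center_subspace L = UNIV"
    using assms(7) unfolding center_full_def h_def e_def by blast
  define p where "p = \<phi> e"
  obtain r C where "lie_coordinates G (\<lambda>g. \<phi> g - p) (\<lambda>x. \<psi> (x + p)) V r C"
    unfolding p_def e_def by (rule lie_group_coordinates[OF assms(1) chart[unfolded e_def]])
  then interpret lie_coordinates G "\<lambda>g. \<phi> g - p" "\<lambda>x. \<psi> (x + p)" V r C .
  have psi_p: "\<psi> p = e" using psi_zero by (simp add: e_def)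
  have shift: "((\<lambda>x. \<phi> (k (\<psi> (x + p))) - p) has_derivative L') (at 0)"
    if "((\<lambda>x. \<phi> (k (\<psi> x))) has_derivative L') (at p)" for k L'
  proof -
    have "((\<lambda>x. x + p) has_derivative (\<lambda>x. x)) (at 0)" by (auto intro!: derivative_eq_intros)
    from has_derivative_compose[OF this, of "\<lambda>x. \<phi> (k (\<psi> x))" L'] that
    have "((\<lambda>x. \<phi> (k (\<psi> (x + p)))) has_derivative L') (at 0)" by simp
    from has_derivative_diff[OF this has_derivative_const[of p]] show ?thesis by simp
  qed
  note dh = shift[OF L[folded p_def]]
  have "smooth_on {x. x \<in> \<phi> ` V \<and> h' (\<psi> x) \<in> V} (\<lambda>x. \<phi> (h' (\<psi> x)))"
    using sm(2) chart(1) unfolding smooth_map_def by fast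
  moreover have "p \<in> {x. x \<in> \<phi> ` V \<and> h' (\<psi> x) \<in> V}"
    using chart(2) psi_p one by (auto simp: p_def)
  ultimately obtain L' where "((\<lambda>x. \<phi> (h' (\<psi> x))) has_derivative L') (at p)"
    by (rule smooth_on_imp_differentiable)
  note dh' = shift[OF this]
  have L_inv: "L' (L x) = x" "L (L' x) = x" for x
    using inverse_derivative[OF one(1)[unfolded e_def] cont(1) inverse(2) dh dh']
      inverse_derivative[OF one(2)[unfolded e_def] cont(2) inverse(1) dh' dh] .
  have spec: "unit_spectrum L"
    by (rule unit_spectrum_center[OF has_derivative_linear[OF dh] center])
  have spec': "unit_spectrum L'"
    by (rule unit_spectrum_inverse[OF spec has_derivative_linear[OF dh'] L_inv(2,1)])
  have affine: "traj f k g u = traj f k e u \<otimes>\<^bsub>G\<^esub> (h ^^ k) g" if "\<And>i. u i \<in> U" for u k g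
    unfolding e_def
  proof (rule traj_affine[where U = U and h = h])
    show "f g u = f \<one>\<^bsub>G\<^esub> u \<otimes>\<^bsub>G\<^esub> h g" if "u \<in> U" for u g 
      by (rule f[OF that, unfolded e_def])
  qed (use hom that is_group in auto)
  define R where "R = reachable_set f U e"
  define Q where "Q = controllable_set f U e"
  have R_I: "traj f k e u \<in> R" if "k \<ge> 1" "\<And>i. u i \<in> U" for k u
    unfolding R_def reachable_set_def using that by blast
  have Q_I: "g \<in> Q" if "traj f k g u = e" "k \<ge> 1" "\<And>i. u i \<in> U" for k u g
    unfolding Q_def controllable_set_def using that by blast
  have R_E: "\<exists>k u. x = traj f k e u \<and> k \<ge> 1 \<and> (\<forall>i. u i \<in> U)" if "x \<in> R" for x
    using that unfolding R_def reachable_set_def by blast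
  have Q_E: "\<exists>k u. traj f k x u = e \<and> k \<ge> 1 \<and> (\<forall>i. u i \<in> U)" if "x \<in> Q" for x
    using that unfolding Q_def controllable_set_def by blast
  have trivial: "traj f 1 g (\<lambda>_. 0) = h g" for g by (simp add: h_def)
  interpret R: contracting_set G "\<lambda>g. \<phi> g - p" "\<lambda>x. \<psi> (x + p)" V r C h h' L R
  proof unfold_locales
    show "open R" using assms(5) by (simp add: R_def e_def)
    show "\<one>\<^bsub>G\<^esub> \<in> R" using R_I[of 1 "\<lambda>_. 0"] trivial[of e] U0 one by (simp add: e_def[symmetric])
    show "h x \<in> R" if x: "x \<in> R" for x
    proof -
      obtain k u where u: "x = traj f k e u" "k \<ge> 1" "\<forall>i. u i \<in> U" using R_E[OF x] by blast
      have "traj f (k + 1) e (\<lambda>i. if i < k then u i else 0) \<in> R"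
        using u U0 by (intro R_I) auto
      then show ?thesis using traj_append[of f k 1 e u "\<lambda>_. 0"] trivial by (simp add: u(1))
    qed
    show "\<exists>k. \<forall>y\<in>R. x \<otimes>\<^bsub>G\<^esub> (h ^^ k) y \<in> R" if x: "x \<in> R" for x
    proof -
      obtain k u where u: "x = traj f k e u" "k \<ge> 1" "\<forall>i. u i \<in> U" using R_E[OF x] by blast
      have "x \<otimes>\<^bsub>G\<^esub> (h ^^ k) y \<in> R" if y: "y \<in> R" for y
      proof -
        obtain l v where v: "y = traj f l e v" "l \<ge> 1" "\<forall>i. v i \<in> U" using R_E[OF y] by blast
        \<comment> \<open>The control leading to y runs first, then the one leading to x. By
          \<open>affine\<close> the end point is x h^k(y), where k is the time used for x.\<close>
        have "traj f (l + k) e (\<lambda>i. if i < l then v i else u (i - l)) \<in> R"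
          using u v by (intro R_I) auto
        then show ?thesis using affine[of u k y] u by (simp add: traj_append v(1))
      qed
      then show ?thesis by blast
    qed
  qed (use hom inverse cont dh spec in auto)
  interpret Q: contracting_set G "\<lambda>g. \<phi> g - p" "\<lambda>x. \<psi> (x + p)" V r C h' h L' Q
  proof unfold_locales
    show "open Q" using assms(6) by (simp add: Q_def e_def)
    show "\<one>\<^bsub>G\<^esub> \<in> Q" using Q_I[of 1 e "\<lambda>_. 0"] trivial[of e] U0 one by (simp add: e_def[symmetric])
    show "h' x \<in> Q" if x: "x \<in> Q" for x
    proof -
      obtain k u where u: "traj f k x u = e" "k \<ge> 1" "\<forall>i. u i \<in> U" using Q_E[OF x] by blast
      \<comment> \<open>One initial step with control 0 brings h' x back to x.\<close>
      have "traj f (1 + k) (h' x) (\<lambda>i. if i < 1 then 0 else u (i - 1)) = e"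
        using traj_append[of f 1 k "h' x" "\<lambda>_. 0" u] by (simp only: trivial inverse u(1))
      then show ?thesis by (rule Q_I) (use u U0 in auto)
    qed
    show "\<exists>k. \<forall>y\<in>Q. x \<otimes>\<^bsub>G\<^esub> (h' ^^ k) y \<in> Q" if x: "x \<in> Q" for x
    proof -
      obtain k u where u: "traj f k x u = e" "k \<ge> 1" "\<forall>i. u i \<in> U" using Q_E[OF x] by blast
      have "x \<otimes>\<^bsub>G\<^esub> (h' ^^ k) y \<in> Q" if y: "y \<in> Q" for y
      proof -
        obtain l v where v: "traj f l y v = e" "l \<ge> 1" "\<forall>i. v i \<in> U" using Q_E[OF y] by blast
        let ?z = "x \<otimes>\<^bsub>G\<^esub> (h' ^^ k) y"
        \<comment> \<open>The power of h' cancels h^k in the affine formula: the control that steers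
          x to e steers \<open>?z\<close> to y, from which v leads to e.\<close>
        have "(h ^^ k) ?z = (h ^^ k) x \<otimes>\<^bsub>G\<^esub> y" by (simp add: R.h_pow_mult R.h_pow_inverse)
        then have "traj f k ?z u = traj f k x u \<otimes>\<^bsub>G\<^esub> y"
          using affine[of u k ?z] affine[of u k x] u(3) by (simp add: m_assoc[symmetric])
        then have "traj f k ?z u = y" by (simp add: u(1) e_def)
        then have "traj f (k + l) ?z (\<lambda>i. if i < k then u i else v (i - k)) = e"
          by (simp add: traj_append v(1))
        then show ?thesis by (rule Q_I) (use u v in auto)
      qed
      then show ?thesis by blast
    qed
  qed (use hom' inverse cont dh' spec' in auto)
  have "R = UNIV" "Q = UNIV"
    using R.S_eq_UNIV[OF assms(2,3)] Q.S_eq_UNIV[OF assms(2,3)] by auto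
  show ?thesis unfolding controllable_def
  proof (intro allI)
    fix x y
    obtain k u where u: "traj f k x u = e" "\<forall>i. u i \<in> U" using Q_E[of x] \<open>Q = UNIV\<close> by blast
    obtain l v where v: "y = traj f l e v" "\<forall>i. v i \<in> U" using R_E[of y] \<open>R = UNIV\<close> by blast
    have "traj f (k + l) x (\<lambda>i. if i < k then u i else v (i - k)) = y"
      by (simp add: traj_append u(1) v(1))
    then show "\<exists>k u. (\<forall>i. u i \<in> U) \<and> traj f k x u = y"
      using u v by (intro exI[of _ "k + l"] exI[of _ "\<lambda>i. if i < k then u i else v (i - k)"]) auto
  qed
qed

end
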